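(* Let $X$ be a fake weighted projective plane with weights $(\lambda_0,\lambda_1,\lambda_2)$ and suppose there is a one-step mutation from $X$ to a fake weighted projective plane $Y$; by relabelling, $Y$ has weights $(\lambda_1,\lambda_2,\lambda_0')$ with $\lambda_0'=(\lambda_1+\lambda_2)^2/\lambda_0$. Write $\lambda_i=c_ia_i^2$ ($i=0,1,2$) and $\lambda_0'=c_0'a_0'^2$ with $a_i,a_0',c_i,c_0'$ positive integers and $c_i,c_0'$ square-free. Then $c_0'=c_0$ and $$\frac{(\lambda_1+\lambda_2+\lambda_0')^2}{\lambda_1\lambda_2\lambda_0'}=\frac{(\lambda_0+\lambda_1+\lambda_2)^2}{\lambda_0\lambda_1\lambda_2}=\frac{m^2}{rk^2}$$ (with $m,k,r$ positive integers, $r$ square-free). Consequently $(a_0,a_1,a_2)$ and $(a_0',a_1,a_2)$ are both solutions of the same Diophantine equation $$mx_0x_1x_2=k\left(c_0x_0^2+c_1x_1^2+c_2x_2^2\right).$$ Moreover $\mathrm{mult}(X)=\mathrm{mult}(Y)$.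
   Context: Let $N\cong\mathbb{Z}^2$ be a lattice, $M=\mathrm{Hom}(N,\mathbb{Z})$ its dual, $N_\mathbb{Q}=N\otimes_\mathbb{Z}\mathbb{Q}$. A Fano polygon is a two-dimensional convex lattice polygon $P\subset N_\mathbb{Q}$ containing the origin in its interior whose vertices are primitive lattice points. For primitive $w\in M$ and $h\in\mathbb{Z}$ put $H_{w,h}=\{v\in N_\mathbb{Q}: w(v)=h\}$, $w_h(P)=\mathrm{conv}(H_{w,h}\cap P\cap N)$ (possibly empty), $h_{\min}=\min_{v\in P}w(v)$, $h_{\max}=\max_{v\in P}w(v)$. A factor of $P$ with respect to $w$ is a lattice polytope $F\subset N_\mathbb{Q}$ with $w(F)=\{0\}$ such that for each integer $h$ with $h_{\min}\le h<0$ there is a (possibly empty) lattice polytope $G_h\subset H_{w,h}$ with $H_{w,h}\cap \mathrm{V}(P)\subseteq G_h+(-h)F\subseteq w_h(P)$, where $\mathrm{V}(P)$ is the vertex set and $+$ is Minkowski sum. The (combinatorial) mutation is $\mathrm{mut}_w(P,F)=\mathrm{conv}\big(\bigcup_{h=h_{\min}}^{-1}G_h\cup\bigcup_{h=0}^{h_{\max}}(w_h(P)+hF)\big)$; up to automorphisms of $N$ it does not depend on the choice of the $G_h$, and it is again a Fano polygon. Polygons are isomorphic ($\cong$) if related by an automorphism of $N$. A Fano triangle $P=\mathrm{conv}(v_0,v_1,v_2)$ determines the toric surface $X_P$ whose fan consists of the cones over the faces of $P$; such a surface is a fake weighted projective plane. Its weights are the unique positive integers $\lambda_0,\lambda_1,\lambda_2$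 with $\gcd(\lambda_0,\lambda_1,\lambda_2)=1$ and $\lambda_0v_0+\lambda_1v_1+\lambda_2v_2=0$; they are pairwise coprime. $\mathrm{mult}(X_P)$ is the index $[N:\mathbb{Z}v_0+\mathbb{Z}v_1+\mathbb{Z}v_2]$. Known facts: $(\lambda_0+\lambda_1+\lambda_2)^2/(\lambda_0\lambda_1\lambda_2)=\mathrm{mult}(X)\,(-K_X)^2$, and the anticanonical degree $(-K_X)^2$ is preserved by mutation. A fake weighted projective plane $Y=X_Q$ is obtained from $X=X_P$ by a one-step mutation if $Q\cong\mathrm{mut}_w(P,F)$ for some primitive $w\in M$ and some factor $F$ of $P$ with respect to $w$. *)

theory Defs
  imports "HOL-Analysis.Analysis" "HOL-Computational_Algebra.Squarefree"
begin

text \<open>N = int x int, embedded into N_R = real x real (convex hulls of lattice points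
  taken over the reals; their lattice points coincide with those of the rational hulls).
  M = int x int acting by the standard pairing.\<close>

type_synonym pt = "real \<times> real"

definition lat :: "int \<times> int \<Rightarrow> pt" where
  "lat v = (of_int (fst v), of_int (snd v))"

definition lattice_pts :: "pt set" where
  "lattice_pts = range lat"

definition lattice_polytope :: "pt set \<Rightarrow> bool" where
  "lattice_polytope S \<longleftrightarrow> (\<exists>A. finite A \<and> A \<subseteq> lattice_pts \<and> S = convex hull A)"

definition primitive :: "int \<times> int \<Rightarrow> bool" where
  "primitive v \<longleftrightarrow> gcd (fst v) (snd v) = 1"

definition vertices :: "pt set \<Rightarrow> pt set" where
  "vertices P = {v. v extreme_point_of P}"

definition fano_polygon :: "pt set \<Rightarrow> bool" where
  "fano_polygon P \<longleftrightarrow> lattice_polytope P \<and> (0::pt) \<in> interior P \<and>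
     (\<forall>v \<in> vertices P. \<exists>z. primitive z \<and> v = lat z)"

definition pair :: "int \<times> int \<Rightarrow> pt \<Rightarrow> real" where
  "pair w v = of_int (fst w) * fst v + of_int (snd w) * snd v"

definition hyper :: "int \<times> int \<Rightarrow> int \<Rightarrow> pt set" where
  "hyper w h = {v. pair w v = of_int h}"

text \<open>w_h(P)\<close>
definition slice :: "int \<times> int \<Rightarrow> int \<Rightarrow> pt set \<Rightarrow> pt set" where
  "slice w h P = convex hull (hyper w h \<inter> P \<inter> lattice_pts)"

definition hmin :: "int \<times> int \<Rightarrow> pt set \<Rightarrow> real" where
  "hmin w P = Inf (pair w ` P)"

definition hmax :: "int \<times> int \<Rightarrow> pt set \<Rightarrow> real" where
  "hmax w P = Sup (pair w ` P)"

definition minkowski :: "pt set \<Rightarrow> pt set \<Rightarrow> pt set" where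
  "minkowski A B = {a + b | a b. a \<in> A \<and> b \<in> B}"

text \<open>F is a factor of P w.r.t. w, with witnessing polytopes G h (for hmin <= h < 0).\<close>
definition is_factor :: "int \<times> int \<Rightarrow> pt set \<Rightarrow> pt set \<Rightarrow> (int \<Rightarrow> pt set) \<Rightarrow> bool" where
  "is_factor w P F G \<longleftrightarrow> lattice_polytope F \<and> pair w ` F = {0} \<and>
     (\<forall>h::int. hmin w P \<le> of_int h \<and> h < 0 \<longrightarrow>
        lattice_polytope (G h) \<and> G h \<subseteq> hyper w h \<and>
        hyper w h \<inter> vertices P \<subseteq> minkowski (G h) (((*\<^sub>R) (of_int (- h))) ` F) \<and>
        minkowski (G h) (((*\<^sub>R) (of_int (- h))) ` F) \<subseteq> slice w h P)"

definition mutation :: "int \<times> int \<Rightarrow> pt set \<Rightarrow> pt set \<Rightarrow> (int \<Rightarrow> pt set) \<Rightarrow> pt set" where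
  "mutation w P F G = convex hull
     ((\<Union>h \<in> {h::int. hmin w P \<le> of_int h \<and> h < 0}. G h) \<union>
      (\<Union>h \<in> {h::int. 0 \<le> h \<and> of_int h \<le> hmax w P}. minkowski (slice w h P) (((*\<^sub>R) (of_int h)) ` F)))"

text \<open>Isomorphism: related by an automorphism of N (an integer matrix of determinant +-1).\<close>
definition iso :: "pt set \<Rightarrow> pt set \<Rightarrow> bool" where
  "iso P Q \<longleftrightarrow> (\<exists>a b c d :: int. \<bar>a * d - b * c\<bar> = 1 \<and>
     Q = (\<lambda>(x, y). (of_int a * x + of_int b * y, of_int c * x + of_int d * y)) ` P)"

definition one_step_mutation :: "pt set \<Rightarrow> pt set \<Rightarrow> bool" where
  "one_step_mutation P Q \<longleftrightarrow>
     (\<exists>w F G. primitive w \<and> is_factor w P F G \<and> iso Q (mutation w P F G))"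

definition triangle :: "int \<times> int \<Rightarrow> int \<times> int \<Rightarrow> int \<times> int \<Rightarrow> pt set" where
  "triangle v0 v1 v2 = convex hull {lat v0, lat v1, lat v2}"

text \<open>Weights of the fake weighted projective plane X_P, P = conv(v0,v1,v2).\<close>
definition fwpp_weights :: "int \<times> int \<Rightarrow> int \<times> int \<Rightarrow> int \<times> int \<Rightarrow> nat \<Rightarrow> nat \<Rightarrow> nat \<Rightarrow> bool" where
  "fwpp_weights v0 v1 v2 l0 l1 l2 \<longleftrightarrow> l0 > 0 \<and> l1 > 0 \<and> l2 > 0 \<and> gcd l0 (gcd l1 l2) = 1 \<and>
     int l0 * fst v0 + int l1 * fst v1 + int l2 * fst v2 = 0 \<and>
     int l0 * snd v0 + int l1 * snd v1 + int l2 * snd v2 = 0"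

definition sublattice :: "int \<times> int \<Rightarrow> int \<times> int \<Rightarrow> int \<times> int \<Rightarrow> (int \<times> int) set" where
  "sublattice v0 v1 v2 = {(a * fst v0 + b * fst v1 + c * fst v2, a * snd v0 + b * snd v1 + c * snd v2) | a b c. True}"

text \<open>mult(X_P) = index [N : Z v0 + Z v1 + Z v2] (number of cosets).\<close>
definition mult :: "int \<times> int \<Rightarrow> int \<times> int \<Rightarrow> int \<times> int \<Rightarrow> nat" where
  "mult v0 v1 v2 = card ((UNIV :: (int \<times> int) set) //
      {(x, y). (fst x - fst y, snd x - snd y) \<in> sublattice v0 v1 v2})"

definition deg_ratio :: "nat \<Rightarrow> nat \<Rightarrow> nat \<Rightarrow> rat" where
  "deg_ratio l0 l1 l2 = of_nat ((l0 + l1 + l2)^2) / of_nat (l0 * l1 * l2)"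

end

theory Submission
  imports Defs
begin

text \<open>From \<open>\<lambda>\<^sub>0 \<lambda>\<^sub>0' = (\<lambda>\<^sub>1 + \<lambda>\<^sub>2)\<^sup>2\<close> the number \<open>c\<^sub>0 c\<^sub>0' (a\<^sub>0 a\<^sub>0')\<^sup>2\<close> is a square, so the
  squarefree parts agree, and the degree ratio is invariant by direct computation.
  Since the weights are pairwise coprime, \<open>c\<^sub>0 c\<^sub>1 c\<^sub>2\<close> is squarefree; hence any presentation
  \<open>m\<^sup>2 / (r k\<^sup>2)\<close> of the ratio has \<open>r = c\<^sub>0 c\<^sub>1 c\<^sub>2\<close>, which is the Diophantine equation.

  For the index, use coordinates \<open>(w \<cdot> z, det (u, z))\<close> with \<open>w \<cdot> u = 1\<close>. The factor is a lattice
  point or a lattice segment \<open>[g\<^sub>a, g\<^sub>b] \<subseteq> w\<^sup>\<bottom>\<close>. A point factor turns the mutation into a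
  unimodular shear. A segment factor forces the bottom of the triangle to be an edge
  \<open>v\<^sub>1 v\<^sub>2\<close> at height \<open>-r\<close> below the top vertex \<open>v\<^sub>0\<close> at height \<open>H\<close>; the mutation is the triangle
  \<open>v\<^sub>1 - r g\<^sub>a = v\<^sub>2 - r g\<^sub>b, v\<^sub>0 + H g\<^sub>a, v\<^sub>0 + H g\<^sub>b\<close>, and after shearing by \<open>g\<^sub>a\<close> the
  relation \<open>\<lambda>\<^sub>0 H = (\<lambda>\<^sub>1 + \<lambda>\<^sub>2) r\<close> with Bezout shows that both triangles span the same
  sublattice.\<close>

section \<open>Sublattices and their index\<close>

definition idot :: "int \<times> int \<Rightarrow> int \<times> int \<Rightarrow> int" where
  "idot w v = fst w * fst v + snd w * snd v"

definition int_lin :: "int \<Rightarrow> int \<Rightarrow> int \<Rightarrow> int \<Rightarrow> int \<times> int \<Rightarrow> int \<times> int" where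
  "int_lin a b c d v = (a * fst v + b * snd v, c * fst v + d * snd v)"

definition int_shear :: "int \<times> int \<Rightarrow> int \<times> int \<Rightarrow> int \<times> int \<Rightarrow> int \<times> int" where
  "int_shear w g v = (fst v + idot w v * fst g, snd v + idot w v * snd g)"

lemma idot_add_scaled: "idot w (fst v + k * fst g, snd v + k * snd g) = idot w v + k * idot w g"
  by (simp add: idot_def algebra_simps)

lemma sublattice_iff:
  "x \<in> sublattice v0 v1 v2 \<longleftrightarrow>
    (\<exists>a b c. x = (a * fst v0 + b * fst v1 + c * fst v2, a * snd v0 + b * snd v1 + c * snd v2))"
  unfolding sublattice_def by auto

lemma sublattice_generators:
  "v0 \<in> sublattice v0 v1 v2" "v1 \<in> sublattice v0 v1 v2" "v2 \<in> sublattice v0 v1 v2"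
  unfolding sublattice_iff
    apply (rule exI[of _ 1], rule exI[of _ 0], rule exI[of _ 0], simp)
   apply (rule exI[of _ 0], rule exI[of _ 1], rule exI[of _ 0], simp)
  apply (rule exI[of _ 0], rule exI[of _ 0], rule exI[of _ 1], simp)
  done

lemma sublattice_subset:
  assumes "u0 \<in> sublattice v0 v1 v2" "u1 \<in> sublattice v0 v1 v2" "u2 \<in> sublattice v0 v1 v2"
  shows "sublattice u0 u1 u2 \<subseteq> sublattice v0 v1 v2"
proof
  fix x assume "x \<in> sublattice u0 u1 u2"
  then obtain a b c where x: "x = (a * fst u0 + b * fst u1 + c * fst u2, a * snd u0 + b * snd u1 + c * snd u2)"
    unfolding sublattice_iff by blast
  obtain a0 b0 c0 where 0: "u0 = (a0 * fst v0 + b0 * fst v1 + c0 * fst v2, a0 * snd v0 + b0 * snd v1 + c0 * snd v2)"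
    using assms(1) unfolding sublattice_iff by blast
  obtain a1 b1 c1 where 1: "u1 = (a1 * fst v0 + b1 * fst v1 + c1 * fst v2, a1 * snd v0 + b1 * snd v1 + c1 * snd v2)"
    using assms(2) unfolding sublattice_iff by blast
  obtain a2 b2 c2 where 2: "u2 = (a2 * fst v0 + b2 * fst v1 + c2 * fst v2, a2 * snd v0 + b2 * snd v1 + c2 * snd v2)"
    using assms(3) unfolding sublattice_iff by blast
  show "x \<in> sublattice v0 v1 v2"
    unfolding sublattice_iff
    by (rule exI[of _ "a*a0+b*a1+c*a2"], rule exI[of _ "a*b0+b*b1+c*b2"], rule exI[of _ "a*c0+b*c1+c*c2"])
      (simp add: x 0 1 2 algebra_simps)
qed

lemma sublattice_eqI:
  assumes "u0 \<in> sublattice v0 v1 v2" "u1 \<in> sublattice v0 v1 v2" "u2 \<in> sublattice v0 v1 v2"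
    "v0 \<in> sublattice u0 u1 u2" "v1 \<in> sublattice u0 u1 u2" "v2 \<in> sublattice u0 u1 u2"
  shows "sublattice u0 u1 u2 = sublattice v0 v1 v2"
  using sublattice_subset assms by blast

lemma mult_eq_if_sublattice_eq:
  "sublattice u0 u1 u2 = sublattice v0 v1 v2 \<Longrightarrow> mult u0 u1 u2 = mult v0 v1 v2"
  unfolding mult_def by simp

lemma mult_eq_if_vertices_eq:
  assumes "{u0, u1, u2} = {v0, v1, v2}"
  shows "mult u0 u1 u2 = mult v0 v1 v2"
proof -
  have gen: "y \<in> sublattice a b c" if "y \<in> {a, b, c}" for y a b c
    using that sublattice_generators by blast
  have "u0 \<in> sublattice v0 v1 v2" "u1 \<in> sublattice v0 v1 v2" "u2 \<in> sublattice v0 v1 v2"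
    by (rule gen, simp add: assms[symmetric])+
  moreover have "v0 \<in> sublattice u0 u1 u2" "v1 \<in> sublattice u0 u1 u2" "v2 \<in> sublattice u0 u1 u2"
    by (rule gen, simp add: assms)+
  ultimately show ?thesis by (intro mult_eq_if_sublattice_eq sublattice_eqI)
qed

lemma mult_swap: "mult v1 v0 v2 = mult v0 v1 v2" "mult v0 v2 v1 = mult v0 v1 v2"
  by (rule mult_eq_if_vertices_eq, blast)+

lemma card_quotient_additive_image:
  fixes f :: "int \<times> int \<Rightarrow> int \<times> int"
  assumes bij: "bij f"
    and add: "\<And>x y. f (fst x - fst y, snd x - snd y) = (fst (f x) - fst (f y), snd (f x) - snd (f y))"
  shows "card (UNIV // {(x, y). (fst x - fst y, snd x - snd y) \<in> f ` L}) =
         card (UNIV // {(x, y). (fst x - fst y, snd x - snd y) \<in> L})"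
proof -
  let ?r = "{(x, y). (fst x - fst y, snd x - snd y) \<in> L}"
  let ?r' = "{(x, y). (fst x - fst y, snd x - snd y) \<in> f ` L}"
  have inj: "inj f" using bij bij_is_inj by blast
  have class_image: "?r' `` {f x} = f ` (?r `` {x})" for x
  proof -
    have "y \<in> ?r' `` {f x} \<longleftrightarrow> y \<in> f ` (?r `` {x})" for y
    proof -
      obtain z where z: "y = f z" using bij by (metis bij_pointE)
      have "y \<in> ?r' `` {f x} \<longleftrightarrow> f (fst x - fst z, snd x - snd z) \<in> f ` L" using add z by simp
      also have "\<dots> \<longleftrightarrow> z \<in> ?r `` {x}" using inj by (simp add: inj_image_mem_iff)
      also have "\<dots> \<longleftrightarrow> y \<in> f ` (?r `` {x})" using inj z by (simp add: inj_image_mem_iff)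
      finally show ?thesis .
    qed
    then show ?thesis by blast
  qed
  have "UNIV // ?r' = (\<lambda>X. f ` X) ` (UNIV // ?r)"
  proof (intro equalityI subsetI)
    fix X assume "X \<in> UNIV // ?r'"
    then obtain y where y: "X = ?r' `` {y}" by (auto elim: quotientE)
    obtain x where "y = f x" using bij by (metis bij_pointE)
    then have "X = f ` (?r `` {x})" using y class_image by simp
    moreover have "?r `` {x} \<in> UNIV // ?r" by (rule quotientI) simp
    ultimately show "X \<in> (\<lambda>X. f ` X) ` (UNIV // ?r)" by blast
  next
    fix X assume "X \<in> (\<lambda>X. f ` X) ` (UNIV // ?r)"
    then obtain x where "X = f ` (?r `` {x})" by (auto elim: quotientE)
    then have "X = ?r' `` {f x}" using class_image by simp
    moreover have "?r' `` {f x} \<in> UNIV // ?r'" by (rule quotientI) simp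
    ultimately show "X \<in> UNIV // ?r'" by simp
  qed
  moreover have "inj_on (\<lambda>X. f ` X) (UNIV // ?r)"
    using inj by (meson inj_image_eq_iff inj_onI)
  ultimately show ?thesis by (simp add: card_image)
qed

lemma sublattice_int_lin:
  "sublattice (int_lin a b c d v0) (int_lin a b c d v1) (int_lin a b c d v2) =
    int_lin a b c d ` sublattice v0 v1 v2"
proof (intro equalityI subsetI)
  fix x assume "x \<in> sublattice (int_lin a b c d v0) (int_lin a b c d v1) (int_lin a b c d v2)"
  then obtain p q r where x: "x =
    (p * fst (int_lin a b c d v0) + q * fst (int_lin a b c d v1) + r * fst (int_lin a b c d v2),
     p * snd (int_lin a b c d v0) + q * snd (int_lin a b c d v1) + r * snd (int_lin a b c d v2))"
    unfolding sublattice_iff by blast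
  let ?y = "(p * fst v0 + q * fst v1 + r * fst v2, p * snd v0 + q * snd v1 + r * snd v2)"
  have "?y \<in> sublattice v0 v1 v2" unfolding sublattice_iff by blast
  moreover have "x = int_lin a b c d ?y" by (simp add: x int_lin_def algebra_simps)
  ultimately show "x \<in> int_lin a b c d ` sublattice v0 v1 v2" by blast
next
  fix x assume "x \<in> int_lin a b c d ` sublattice v0 v1 v2"
  then obtain y where "y \<in> sublattice v0 v1 v2" and xy: "x = int_lin a b c d y" by blast
  then obtain p q r where
    x: "x = int_lin a b c d (p * fst v0 + q * fst v1 + r * fst v2, p * snd v0 + q * snd v1 + r * snd v2)"
    unfolding sublattice_iff by blast
  show "x \<in> sublattice (int_lin a b c d v0) (int_lin a b c d v1) (int_lin a b c d v2)"
    unfolding sublattice_iff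
    by (rule exI[of _ p], rule exI[of _ q], rule exI[of _ r]) (simp add: x int_lin_def algebra_simps)
qed

lemma unimodular_det_square: "\<bar>a * d - b * c\<bar> = 1 \<Longrightarrow> (a * d - b * c) * (a * d - b * c) = (1::int)"
  by (metis abs_mult_self_eq mult_1)

lemma bij_int_lin:
  assumes "\<bar>a * d - b * c\<bar> = 1"
  shows "bij (int_lin a b c d)"
proof -
  define \<delta> where "\<delta> = a * d - b * c"
  have \<delta>: "\<delta> * \<delta> = 1" using unimodular_det_square[OF assms] by (simp add: \<delta>_def)
  let ?g = "int_lin (\<delta> * d) (- \<delta> * b) (- \<delta> * c) (\<delta> * a)"
  have "int_lin a b c d (?g x) = (\<delta> * \<delta> * fst x, \<delta> * \<delta> * snd x)"
    "?g (int_lin a b c d x) = (\<delta> * \<delta> * fst x, \<delta> * \<delta> * snd x)" for x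
    by (simp_all add: int_lin_def \<delta>_def algebra_simps)
  then have inv: "int_lin a b c d (?g x) = x" "?g (int_lin a b c d x) = x" for x
    using \<delta> by simp_all
  show ?thesis by (rule bijI'; metis inv)
qed

lemma mult_int_lin:
  assumes "\<bar>a * d - b * c\<bar> = 1"
  shows "mult (int_lin a b c d v0) (int_lin a b c d v1) (int_lin a b c d v2) = mult v0 v1 v2"
  unfolding mult_def sublattice_int_lin
  by (rule card_quotient_additive_image[OF bij_int_lin[OF assms]]) (simp add: int_lin_def algebra_simps)

lemma mult_int_shear:
  assumes "idot w g = 0"
  shows "mult (int_shear w g v0) (int_shear w g v1) (int_shear w g v2) = mult v0 v1 v2"
proof -
  have "int_shear w g = int_lin (1 + fst g * fst w) (fst g * snd w) (snd g * fst w) (1 + snd g * snd w)"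
    by (simp add: fun_eq_iff int_shear_def int_lin_def idot_def algebra_simps)
  moreover have "(1 + fst g * fst w) * (1 + snd g * snd w) - fst g * snd w * (snd g * fst w) = 1 + idot w g"
    by (simp add: idot_def algebra_simps)
  ultimately show ?thesis using mult_int_lin assms by simp
qed

section \<open>Squarefree parts and the degree ratio\<close>

lemma squarefree_eq_if_mult_squares_eq:
  fixes x y B D :: nat
  assumes "squarefree x" "squarefree y" "B \<noteq> 0" "D \<noteq> 0" and eq: "x * B^2 = y * D^2"
  shows "x = y"
proof -
  have nz: "x \<noteq> 0" "y \<noteq> 0" using assms(1,2) not_squarefree_0 by metis+
  have "multiplicity p x = multiplicity p y" if p: "prime p" for p
  proof -
    have "multiplicity p x + 2 * multiplicity p B = multiplicity p y + 2 * multiplicity p D"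
      using arg_cong[OF eq, of "multiplicity p"] p nz assms(3,4)
      by (simp add: prime_elem_multiplicity_mult_distrib prime_elem_multiplicity_power_distrib)
    moreover have "multiplicity p x \<le> 1" "multiplicity p y \<le> 1"
      using assms(1,2) nz p squarefree_factorial_semiring'' by blast+
    ultimately show ?thesis by presburger
  qed
  then have "normalize x = normalize y" using multiplicity_eq_imp_eq nz by blast
  then show ?thesis by simp
qed

lemma squarefree_eq_if_product_square:
  fixes x y A B :: nat
  assumes "squarefree x" "squarefree y" "A \<noteq> 0" and eq: "x * y * A^2 = B^2"
  shows "x = y"
proof (rule squarefree_eq_if_mult_squares_eq[OF assms(1,2)])
  have "x * (y * A)^2 = y * (x * y * A^2)" by (simp add: power2_eq_square algebra_simps)
  then show "x * (y * A)^2 = y * B^2" by (simp only: eq)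
  have "x \<noteq> 0" "y \<noteq> 0" using assms(1,2) not_squarefree_0 by metis+
  then show "y * A \<noteq> 0" using assms(3) by simp
  show "B \<noteq> 0"
  proof
    assume "B = 0"
    then show False using eq \<open>x \<noteq> 0\<close> \<open>y \<noteq> 0\<close> assms(3) by simp
  qed
qed

lemma dioph_if_squarefree_ratio_eq:
  fixes C r S A m k :: nat
  assumes "squarefree C" "squarefree r" "k > 0" "A > 0" "S > 0" "m > 0"
    and eq: "S^2 * (r * k^2) = m^2 * (C * A^2)"
  shows "m * A = k * S"
proof -
  have "r * (S * k)^2 = C * (m * A)^2" using eq by (simp add: power_mult_distrib algebra_simps)
  moreover from this have "r = C"
    using squarefree_eq_if_mult_squares_eq[of r C "S * k" "m * A"] assms by simp
  ultimately have "(S * k)^2 = (m * A)^2" using assms(1) by (cases "C = 0") auto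
  then show ?thesis by (simp add: power2_eq_iff_nonneg mult.commute)
qed

lemma of_nat_frac_eq_iff:
  fixes a b c d :: nat
  assumes "b > 0" "d > 0"
  shows "(of_nat a / of_nat b :: rat) = of_nat c / of_nat d \<longleftrightarrow> a * d = c * b"
proof -
  have "(of_nat a / of_nat b :: rat) = of_nat c / of_nat d \<longleftrightarrow> of_nat a * of_nat d = (of_nat c * of_nat b :: rat)"
    using assms by (simp add: frac_eq_eq)
  also have "\<dots> \<longleftrightarrow> a * d = c * b" by (simp only: of_nat_mult[symmetric] of_nat_eq_iff)
  finally show ?thesis .
qed

lemma deg_ratio_eq_iff:
  assumes "l0 > 0" "l1 > 0" "l2 > 0" "d > 0"
  shows "deg_ratio l0 l1 l2 = of_nat n / of_nat d \<longleftrightarrow> (l0 + l1 + l2)^2 * d = n * (l0 * l1 * l2)"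
  unfolding deg_ratio_def by (rule of_nat_frac_eq_iff) (use assms in simp_all)

lemma squarefree_part_mutation:
  fixes c0 c0' a0 a0' l1 l2 :: nat
  assumes "c0 * a0^2 * (c0' * a0'^2) = (l1 + l2)^2" "squarefree c0" "squarefree c0'" "a0 > 0" "a0' > 0"
  shows "c0' = c0"
proof (rule squarefree_eq_if_product_square[OF assms(3,2)])
  show "c0' * c0 * (a0' * a0)^2 = (l1 + l2)^2" using assms(1) by (simp add: power_mult_distrib ac_simps)
qed (use assms(4,5) in simp)

lemma deg_ratio_rotate: "deg_ratio l1 l2 l0 = deg_ratio l0 l1 l2"
  by (simp add: deg_ratio_def ac_simps)

lemma squarefree_product_of_coprime_parts:
  fixes c0 c1 c2 a0 a1 a2 :: nat
  assumes sf: "squarefree c0" "squarefree c1" "squarefree c2"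
    and cop: "coprime (c0 * a0^2) (c1 * a1^2)" "coprime (c0 * a0^2) (c2 * a2^2)" "coprime (c1 * a1^2) (c2 * a2^2)"
  shows "squarefree (c0 * c1 * c2)"
proof -
  have "coprime c0 c1" "coprime c0 c2" "coprime c1 c2"
    using cop by (auto intro: coprime_divisors[of c0 _ c1] coprime_divisors[of c0 _ c2] coprime_divisors[of c1 _ c2])
  then show ?thesis using sf by (simp add: squarefree_mult_coprime)
qed

lemma deg_ratio_mutation:
  assumes "l0 > 0" "l1 > 0" "l2 > 0" and l0': "l0 * l0' = (l1 + l2)^2"
  shows "deg_ratio l1 l2 l0' = deg_ratio l0 l1 l2"
proof -
  have "l0' > 0" using assms by (cases "l0' = 0") auto
  moreover have "int l0 * int l0' = (int l1 + int l2)^2" using l0' by (metis of_nat_add of_nat_mult of_nat_power)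
  then have "(int l1 + int l2 + int l0')^2 * (int l0 * int l1 * int l2) =
      (int l0 + int l1 + int l2)^2 * (int l1 * int l2 * int l0')"
    by algebra
  then have "(l1 + l2 + l0')^2 * (l0 * l1 * l2) = (l0 + l1 + l2)^2 * (l1 * l2 * l0')"
    by (simp only: of_nat_add[symmetric] of_nat_mult[symmetric] of_nat_power[symmetric] of_nat_eq_iff)
  ultimately show ?thesis
    unfolding deg_ratio_def using assms by (intro iffD2[OF of_nat_frac_eq_iff]) simp_all
qed

text \<open>Comparing squarefree parts of the denominators forces \<open>r = C\<close>.\<close>
lemma deg_ratio_squarefree_presentation:
  fixes c0 c1 c2 a0 a1 a2 :: nat
  defines "C \<equiv> c0 * c1 * c2" and "A \<equiv> a0 * a1 * a2" and "S \<equiv> c0 * a0^2 + c1 * a1^2 + c2 * a2^2"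
  assumes pos: "a0 > 0" "a1 > 0" "a2 > 0" "c0 > 0" "c1 > 0" "c2 > 0"
  shows "deg_ratio (c0 * a0^2) (c1 * a1^2) (c2 * a2^2) = of_nat (S^2) / of_nat (C * A^2)"
    and "squarefree C \<Longrightarrow> m > 0 \<Longrightarrow> k > 0 \<Longrightarrow> squarefree r \<Longrightarrow>
      deg_ratio (c0 * a0^2) (c1 * a1^2) (c2 * a2^2) = of_nat (m^2) / of_nat (r * k^2) \<Longrightarrow> m * A = k * S"
proof -
  have CAS: "C > 0" "A > 0" "S > 0" using pos by (simp_all add: C_def A_def S_def)
  have ratio_iff: "deg_ratio (c0 * a0^2) (c1 * a1^2) (c2 * a2^2) = of_nat n / of_nat d \<longleftrightarrow>
      S^2 * d = n * (C * A^2)" if "d > 0" for n d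
  proof -
    have "c0 * a0^2 * (c1 * a1^2) * (c2 * a2^2) = C * A^2"
      by (simp add: C_def A_def power_mult_distrib algebra_simps)
    moreover have "c0 * a0^2 + c1 * a1^2 + c2 * a2^2 = S" by (simp add: S_def)
    ultimately show ?thesis using deg_ratio_eq_iff[of "c0 * a0^2" "c1 * a1^2" "c2 * a2^2" d n] pos that
      by simp
  qed
  show "deg_ratio (c0 * a0^2) (c1 * a1^2) (c2 * a2^2) = of_nat (S^2) / of_nat (C * A^2)"
    by (subst ratio_iff) (use CAS in simp_all)
  assume C: "squarefree C" and mkr: "m > 0" "k > 0" "squarefree r"
    and ratio: "deg_ratio (c0 * a0^2) (c1 * a1^2) (c2 * a2^2) = of_nat (m^2) / of_nat (r * k^2)"
  have "r > 0" using mkr(3) by (cases "r = 0") auto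
  then have "S^2 * (r * k^2) = m^2 * (C * A^2)" using ratio ratio_iff[of "r * k^2" "m^2"] mkr by simp
  then show "m * A = k * S" using dioph_if_squarefree_ratio_eq[OF C mkr(3)] CAS mkr by blast
qed

lemma fwpp_weights_swap:
  assumes "fwpp_weights v0 v1 v2 l0 l1 l2"
  shows "fwpp_weights v1 v0 v2 l1 l0 l2" "fwpp_weights v0 v2 v1 l0 l2 l1"
  using assms unfolding fwpp_weights_def
  by (simp_all add: gcd.left_commute gcd.commute algebra_simps)

text \<open>A common divisor of \<open>\<lambda>\<^sub>1, \<lambda>\<^sub>2\<close> divides \<open>\<lambda>\<^sub>0 v\<^sub>0\<close>, hence \<open>\<lambda>\<^sub>0\<close> as \<open>v\<^sub>0\<close> is primitive.\<close>
lemma fwpp_weights_coprime: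
  assumes w: "fwpp_weights v0 v1 v2 l0 l1 l2" and prim: "primitive v0"
  shows "coprime l1 l2"
proof -
  let ?g = "int (gcd l1 l2)"
  have "?g dvd int l1" "?g dvd int l2" by (simp_all add: int_dvd_int_iff)
  then have "?g dvd int l1 * fst v1 + int l2 * fst v2" "?g dvd int l1 * snd v1 + int l2 * snd v2"
    by simp_all
  moreover have "int l0 * fst v0 = - (int l1 * fst v1 + int l2 * fst v2)"
    "int l0 * snd v0 = - (int l1 * snd v1 + int l2 * snd v2)"
    using w unfolding fwpp_weights_def by linarith+
  ultimately have "?g dvd gcd (int l0 * fst v0) (int l0 * snd v0)" by simp
  also have "gcd (int l0 * fst v0) (int l0 * snd v0) = int l0"
    using prim by (simp add: gcd_mult_left primitive_def)
  finally have "gcd l1 l2 dvd gcd l0 (gcd l1 l2)" by (simp add: int_dvd_int_iff)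
  then show ?thesis using w by (simp add: fwpp_weights_def coprime_iff_gcd_eq_1)
qed

section \<open>Coordinates, affine functions and extreme points\<close>

definition cross :: "int \<times> int \<Rightarrow> pt \<Rightarrow> real" where
  "cross u z = of_int (fst u) * snd z - of_int (snd u) * fst z"

definition icross :: "int \<times> int \<Rightarrow> int \<times> int \<Rightarrow> int" where
  "icross u v = fst u * snd v - snd u * fst v"

definition real_lin :: "int \<Rightarrow> int \<Rightarrow> int \<Rightarrow> int \<Rightarrow> pt \<Rightarrow> pt" where
  "real_lin a b c d z = (of_int a * fst z + of_int b * snd z, of_int c * fst z + of_int d * snd z)"

definition affine_fn :: "(pt \<Rightarrow> real) \<Rightarrow> bool" where
  "affine_fn f \<longleftrightarrow> (\<forall>x y u. f ((1 - u) *\<^sub>R x + u *\<^sub>R y) = (1 - u) * f x + u * f y)"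

lemma lat_eq_iff [simp]: "lat x = lat y \<longleftrightarrow> x = y"
  by (simp add: lat_def prod_eq_iff)

lemma lat_in_lattice_pts [simp]: "lat v \<in> lattice_pts"
  by (simp add: lattice_pts_def)

lemma lat_image_eq_iff: "{lat a, lat b, lat c} = {lat x, lat y, lat z} \<longleftrightarrow> {a, b, c} = {x, y, z}"
proof -
  have "inj lat" by (simp add: inj_def)
  then have "lat ` {a, b, c} = lat ` {x, y, z} \<longleftrightarrow> {a, b, c} = {x, y, z}" by (rule inj_image_eq_iff)
  then show ?thesis by simp
qed

lemma pair_add: "pair w (x + y) = pair w x + pair w y"
  and pair_diff: "pair w (x - y) = pair w x - pair w y"
  and pair_scaleR: "pair w (c *\<^sub>R x) = c * pair w x"
  and pair_lat: "pair w (lat v) = of_int (idot w v)"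
  by (simp_all add: pair_def lat_def idot_def algebra_simps)

lemma cross_add: "cross u (x + y) = cross u x + cross u y"
  and cross_diff: "cross u (x - y) = cross u x - cross u y"
  and cross_scaleR: "cross u (c *\<^sub>R x) = c * cross u x"
  and cross_lat: "cross u (lat v) = of_int (icross u v)"
  by (simp_all add: cross_def lat_def icross_def algebra_simps)

text \<open>For primitive \<open>w\<close> choose \<open>u\<close> with \<open>w \<cdot> u = 1\<close>; then \<open>(pair w, cross u)\<close> are
  unimodular coordinates on the plane.\<close>
lemma eq_if_pair_cross_eq:
  assumes wu: "idot w u = 1" and "pair w x = pair w y" "cross u x = cross u y"
  shows "x = y"
proof -
  have "fst z = of_int (fst u) * pair w z - of_int (snd w) * cross u z"
    "snd z = of_int (snd u) * pair w z + of_int (fst w) * cross u z" for z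
  proof -
    have "real_of_int (fst w) * of_int (fst u) + of_int (snd w) * of_int (snd u) = 1"
      using wu unfolding idot_def by (metis of_int_1 of_int_add of_int_mult)
    moreover have "of_int (fst u) * pair w z - of_int (snd w) * cross u z =
        fst z * (of_int (fst w) * of_int (fst u) + of_int (snd w) * of_int (snd u))"
      "of_int (snd u) * pair w z + of_int (fst w) * cross u z =
        snd z * (of_int (fst w) * of_int (fst u) + of_int (snd w) * of_int (snd u))"
      by (simp_all add: pair_def cross_def algebra_simps)
    ultimately show "fst z = of_int (fst u) * pair w z - of_int (snd w) * cross u z"
      "snd z = of_int (snd u) * pair w z + of_int (fst w) * cross u z" by simp_all
  qed
  then show ?thesis using assms(2,3) by (simp add: prod_eq_iff)
qed

lemma primitive_coordinate:
  assumes "primitive w"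
  obtains u where "idot w u = 1"
proof -
  obtain s t where "s * fst w + t * snd w = gcd (fst w) (snd w)" using bezout_int by blast
  then have "idot w (s, t) = 1" using assms by (simp add: primitive_def idot_def algebra_simps)
  then show ?thesis using that by blast
qed

lemma affine_fn_const: "affine_fn (\<lambda>z. c)"
  and affine_fn_pair: "affine_fn (pair w)"
  and affine_fn_cross: "affine_fn (cross u)"
  by (simp_all add: affine_fn_def pair_def cross_def algebra_simps)

lemma affine_fn_add: "affine_fn f \<Longrightarrow> affine_fn g \<Longrightarrow> affine_fn (\<lambda>z. f z + g z)"
  and affine_fn_diff: "affine_fn f \<Longrightarrow> affine_fn g \<Longrightarrow> affine_fn (\<lambda>z. f z - g z)"
  and affine_fn_mult_left: "affine_fn f \<Longrightarrow> affine_fn (\<lambda>z. c * f z)"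
  and affine_fn_mult_right: "affine_fn f \<Longrightarrow> affine_fn (\<lambda>z. f z * c)"
  unfolding affine_fn_def by (simp only:, simp add: algebra_simps)+

lemmas affine_fn_intros = affine_fn_const affine_fn_pair affine_fn_cross affine_fn_add
  affine_fn_diff affine_fn_mult_left affine_fn_mult_right

lemma convex_affine_fn_nonneg: "affine_fn f \<Longrightarrow> convex {z. 0 \<le> f z}"
  unfolding convex_alt affine_fn_def by simp

lemma affine_fn_nonneg_convex_hull:
  assumes "affine_fn f" "\<And>x. x \<in> S \<Longrightarrow> 0 \<le> f x" "z \<in> convex hull S"
  shows "0 \<le> f z"
  using hull_minimal[of S "{z. 0 \<le> f z}" convex] convex_affine_fn_nonneg assms by blast

lemma extreme_point_by_affine_fns:
  assumes z: "z \<in> T" and af: "affine_fn f" "affine_fn g"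
    and nonneg: "\<And>x. x \<in> T \<Longrightarrow> 0 \<le> f x" "\<And>x. x \<in> T \<Longrightarrow> 0 \<le> g x"
    and zero: "f z = 0" "g z = 0"
    and unique: "\<And>x. x \<in> T \<Longrightarrow> f x = 0 \<Longrightarrow> g x = 0 \<Longrightarrow> x = z"
  shows "z extreme_point_of T"
proof -
  have "z \<notin> open_segment x y" if xy: "x \<in> T" "y \<in> T" for x y
  proof
    assume "z \<in> open_segment x y"
    then obtain c where c: "x \<noteq> y" "0 < c" "c < 1" "z = (1 - c) *\<^sub>R x + c *\<^sub>R y"
      by (auto simp: in_segment)
    have "(1 - c) * f x + c * f y = 0" "(1 - c) * g x + c * g y = 0"
      using zero c(4) af unfolding affine_fn_def by metis+
    moreover have "0 \<le> f x" "0 \<le> f y" "0 \<le> g x" "0 \<le> g y" using nonneg xy by auto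
    ultimately have "f x = 0 \<and> f y = 0 \<and> g x = 0 \<and> g y = 0" using c(2,3)
      by (smt (verit) mult_pos_pos mult_nonneg_nonneg)
    then have "x = z" "y = z" using unique xy by blast+
    then show False using c(1) by simp
  qed
  then show ?thesis using z by (auto simp: extreme_point_of_def)
qed

lemma extreme_point_of_linear_image:
  fixes f :: "'a::real_vector \<Rightarrow> 'b::real_vector"
  assumes "linear f" "inj f" "x extreme_point_of S"
  shows "f x extreme_point_of (f ` S)"
proof -
  interpret linear f by fact
  have "f x \<notin> open_segment (f a) (f b)" if "a \<in> S" "b \<in> S" for a b
  proof
    assume "f x \<in> open_segment (f a) (f b)"
    then obtain c where c: "f a \<noteq> f b" "0 < c" "c < 1" "f x = (1 - c) *\<^sub>R f a + c *\<^sub>R f b"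
      by (auto simp: in_segment)
    then have "f x = f ((1 - c) *\<^sub>R a + c *\<^sub>R b)" by (simp add: add scale)
    then have "x = (1 - c) *\<^sub>R a + c *\<^sub>R b" using assms(2) by (simp add: inj_eq)
    moreover have "a \<noteq> b" using c by auto
    ultimately have "x \<in> open_segment a b" using c by (auto simp: in_segment)
    then show False using assms(3) that by (auto simp: extreme_point_of_def)
  qed
  then show ?thesis using assms(3) by (auto simp: extreme_point_of_def)
qed

lemma extreme_point_of_subset:
  "x extreme_point_of T \<Longrightarrow> x \<in> S \<Longrightarrow> S \<subseteq> T \<Longrightarrow> x extreme_point_of S"
  by (auto simp: extreme_point_of_def)

lemma linear_real_lin: "linear (real_lin a b c d)"
  by (rule linearI) (simp_all add: real_lin_def algebra_simps)

lemma real_lin_lat: "real_lin a b c d (lat v) = lat (int_lin a b c d v)"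
  by (simp add: real_lin_def lat_def int_lin_def)

lemma real_lin_inverse:
  fixes a b c d :: int
  defines "\<delta> \<equiv> a * d - b * c"
  assumes det: "\<bar>\<delta>\<bar> = 1"
  shows "\<bar>(\<delta> * d) * (\<delta> * a) - (- \<delta> * b) * (- \<delta> * c)\<bar> = 1"
    and "real_lin (\<delta> * d) (- \<delta> * b) (- \<delta> * c) (\<delta> * a) (real_lin a b c d z) = z"
proof -
  have \<delta>: "\<delta> * \<delta> = 1" using unimodular_det_square det unfolding \<delta>_def by blast
  have "(\<delta> * d) * (\<delta> * a) - (- \<delta> * b) * (- \<delta> * c) = (\<delta> * \<delta>) * \<delta>"
    by (simp add: \<delta>_def algebra_simps)
  then show "\<bar>(\<delta> * d) * (\<delta> * a) - (- \<delta> * b) * (- \<delta> * c)\<bar> = 1" using \<delta> det by simp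
  have "real_lin (\<delta> * d) (- \<delta> * b) (- \<delta> * c) (\<delta> * a) (real_lin a b c d z) =
      (of_int (\<delta> * \<delta>) * fst z, of_int (\<delta> * \<delta>) * snd z)"
    by (simp add: real_lin_def \<delta>_def algebra_simps)
  then show "real_lin (\<delta> * d) (- \<delta> * b) (- \<delta> * c) (\<delta> * a) (real_lin a b c d z) = z"
    using \<delta> by simp
qed

lemma inj_real_lin:
  assumes "\<bar>a * d - b * c\<bar> = 1"
  shows "inj (real_lin a b c d)"
  by (rule inj_on_inverseI[where g = "real_lin _ _ _ _"], rule real_lin_inverse(2)[OF assms])

lemma extreme_point_of_real_lin_image:
  assumes "\<bar>a * d - b * c\<bar> = 1" "x extreme_point_of S"
  shows "real_lin a b c d x extreme_point_of (real_lin a b c d ` S)"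
  by (rule extreme_point_of_linear_image[OF linear_real_lin inj_real_lin]) fact+

section \<open>Fano triangles and mutations\<close>

lemma extreme_points_triangle:
  fixes A B C :: pt
  assumes int: "0 \<in> interior (convex hull {A, B, C})"
  shows "A \<noteq> B" "A \<noteq> C" "B \<noteq> C" "{x. x extreme_point_of (convex hull {A, B, C})} = {A, B, C}"
proof -
  have flat: "interior (convex hull {X, Y}) = {}" for X Y :: pt
    by (rule empty_interior_convex_hull) (auto simp: card_insert_if)
  show "A \<noteq> B" "A \<noteq> C" "B \<noteq> C"
    using int flat[of A C] flat[of A B] by (auto simp: insert_commute)
  let ?E = "{x. x extreme_point_of (convex hull {A, B, C})}"
  have KM: "convex hull {A, B, C} = convex hull ?E"
    by (rule Krein_Milman_polytope) simp
  have sub: "?E \<subseteq> {A, B, C}" by (rule extreme_points_of_convex_hull)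
  have "X \<in> ?E" if X: "X \<in> {A, B, C}" for X
  proof (rule ccontr)
    assume nX: "X \<notin> ?E"
    have "X = A \<or> X = B \<or> X = C" using X by simp
    then obtain Y Z where YZ: "{A, B, C} = {X, Y, Z}"
    proof (elim disjE)
      assume "X = A" then show ?thesis using that[of B C] by simp
    next
      assume "X = B" then show ?thesis using that[of A C] by (simp add: insert_commute)
    next
      assume "X = C" then have "{A, B, C} = {X, A, B}" by (simp add: insert_commute)
      then show ?thesis using that by blast
    qed
    have "?E \<subseteq> {Y, Z}"
    proof
      fix x assume x: "x \<in> ?E"
      then have "x \<in> {X, Y, Z}" using sub YZ by (simp only: subset_iff)
      moreover have "x \<noteq> X" using x nX by auto
      ultimately show "x \<in> {Y, Z}" by simp
    qed
    then have "convex hull ?E \<subseteq> convex hull {Y, Z}" by (rule hull_mono)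
    then have "convex hull {A, B, C} \<subseteq> convex hull {Y, Z}" by (rule ord_eq_le_trans[OF KM])
    then have "interior (convex hull {A, B, C}) \<subseteq> interior (convex hull {Y, Z})" by (rule interior_mono)
    then show False using int flat[of Y Z] by blast
  qed
  then show "?E = {A, B, C}" using sub by blast
qed

lemma fano_triangle:
  assumes "fano_polygon (triangle v0 v1 v2)"
  shows "v0 \<noteq> v1" "v0 \<noteq> v2" "v1 \<noteq> v2"
    "vertices (triangle v0 v1 v2) = {lat v0, lat v1, lat v2}"
    "primitive v0" "primitive v1" "primitive v2"
    "0 \<in> interior (triangle v0 v1 v2)"
proof -
  have int: "0 \<in> interior (convex hull {lat v0, lat v1, lat v2})"
    using assms unfolding fano_polygon_def triangle_def by blast
  note T = extreme_points_triangle[OF int]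
  show "v0 \<noteq> v1" "v0 \<noteq> v2" "v1 \<noteq> v2" using T(1-3) by auto
  show V: "vertices (triangle v0 v1 v2) = {lat v0, lat v1, lat v2}"
    using T(4) unfolding vertices_def triangle_def .
  have "\<forall>v \<in> vertices (triangle v0 v1 v2). \<exists>z. primitive z \<and> v = lat z"
    using assms unfolding fano_polygon_def by blast
  then show "primitive v0" "primitive v1" "primitive v2" unfolding V by auto
  show "0 \<in> interior (triangle v0 v1 v2)" using int unfolding triangle_def .
qed

lemma fano_weights_pairwise_coprime:
  assumes P: "fano_polygon (triangle v0 v1 v2)" and wX: "fwpp_weights v0 v1 v2 l0 l1 l2"
  shows "coprime l0 l1" "coprime l0 l2" "coprime l1 l2"
proof -
  note PF = fano_triangle[OF P]
  show "coprime l0 l1"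
    using fwpp_weights_coprime[OF fwpp_weights_swap(1)[OF fwpp_weights_swap(2)[OF wX]] PF(7)] .
  show "coprime l0 l2" using fwpp_weights_coprime[OF fwpp_weights_swap(1)[OF wX] PF(6)] .
  show "coprime l1 l2" using fwpp_weights_coprime[OF wX PF(5)] .
qed

lemma triangle_swap: "triangle v1 v0 v2 = triangle v0 v1 v2" "triangle v0 v2 v1 = triangle v0 v1 v2"
  by (simp_all add: triangle_def insert_commute)

lemma lat_in_triangle: "lat v0 \<in> triangle v0 v1 v2" "lat v1 \<in> triangle v0 v1 v2" "lat v2 \<in> triangle v0 v1 v2"
  unfolding triangle_def by (simp_all add: hull_inc)

lemma triangle_barycentric:
  assumes "z \<in> triangle v0 v1 v2"
  obtains a b c where "0 \<le> a" "0 \<le> b" "0 \<le> c" "a + b + c = 1"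
    "z = a *\<^sub>R lat v0 + b *\<^sub>R lat v1 + c *\<^sub>R lat v2"
proof -
  obtain a b c where "0 \<le> a" "0 \<le> b" "0 \<le> c" "a + b + c = 1"
    "z = a *\<^sub>R lat v0 + b *\<^sub>R lat v1 + c *\<^sub>R lat v2"
    using assms unfolding triangle_def convex_hull_3 by auto
  then show ?thesis using that by blast
qed

lemma affine_fn_nonneg_triangle:
  assumes "affine_fn f" "0 \<le> f (lat v0)" "0 \<le> f (lat v1)" "0 \<le> f (lat v2)" "z \<in> triangle v0 v1 v2"
  shows "0 \<le> f z"
proof (rule affine_fn_nonneg_convex_hull[OF assms(1)])
  show "z \<in> convex hull {lat v0, lat v1, lat v2}" using assms(5) unfolding triangle_def .
qed (use assms(2-4) in blast)

lemma triangle_pair_bounds: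
  assumes "z \<in> triangle v0 v1 v2"
  shows "of_int (min (idot w v0) (min (idot w v1) (idot w v2))) \<le> pair w z"
    and "pair w z \<le> of_int (max (idot w v0) (max (idot w v1) (idot w v2)))"
proof -
  let ?m = "min (idot w v0) (min (idot w v1) (idot w v2))"
  let ?M = "max (idot w v0) (max (idot w v1) (idot w v2))"
  have "0 \<le> pair w z - of_int ?m"
    by (rule affine_fn_nonneg_triangle[OF affine_fn_diff[OF affine_fn_pair affine_fn_const] _ _ _ assms])
      (simp_all add: pair_lat)
  moreover have "0 \<le> of_int ?M - pair w z"
    by (rule affine_fn_nonneg_triangle[OF affine_fn_diff[OF affine_fn_const affine_fn_pair] _ _ _ assms])
      (simp_all add: pair_lat)
  ultimately show "of_int ?m \<le> pair w z" "pair w z \<le> of_int ?M" by simp_all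
qed

lemma triangle_hmin_hmax:
  "hmin w (triangle v0 v1 v2) = of_int (min (idot w v0) (min (idot w v1) (idot w v2)))"
  "hmax w (triangle v0 v1 v2) = of_int (max (idot w v0) (max (idot w v1) (idot w v2)))"
proof -
  let ?T = "triangle v0 v1 v2"
  let ?m = "min (idot w v0) (min (idot w v1) (idot w v2))"
  let ?M = "max (idot w v0) (max (idot w v1) (idot w v2))"
  have attained: "of_int (idot w v) \<in> pair w ` ?T" if "v \<in> {v0, v1, v2}" for v
  proof -
    have "lat v \<in> ?T" using that lat_in_triangle by blast
    then show ?thesis using image_eqI[of "of_int (idot w v)" "pair w" "lat v"] by (simp add: pair_lat)
  qed
  have "?m = idot w v0 \<or> ?m = idot w v1 \<or> ?m = idot w v2"
    "?M = idot w v0 \<or> ?M = idot w v1 \<or> ?M = idot w v2" by linarith+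
  then have "of_int ?m \<in> pair w ` ?T" "of_int ?M \<in> pair w ` ?T"
    using attained[of v0] attained[of v1] attained[of v2] by auto
  then show "hmin w ?T = of_int ?m" "hmax w ?T = of_int ?M"
    unfolding hmin_def hmax_def
    by (auto intro!: cInf_eq_minimum cSup_eq_maximum intro: triangle_pair_bounds)
qed

lemma interior_pair_signs:
  assumes "0 \<in> interior P" "w \<noteq> (0, 0)"
  obtains z1 z2 where "z1 \<in> P" "pair w z1 > 0" "z2 \<in> P" "pair w z2 < 0"
proof -
  obtain e where e: "e > 0" "ball 0 e \<subseteq> P" using assms(1) by (meson mem_interior)
  define W :: pt where "W = (of_int (fst w), of_int (snd w))"
  have "W \<noteq> 0" using assms(2) by (auto simp: W_def prod_eq_iff)
  then have nW: "norm W > 0" by simp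
  define c where "c = e / (2 * norm W)"
  have c: "c > 0" using e nW by (simp add: c_def)
  have "pair w W = of_int (fst w)^2 + of_int (snd w)^2" by (simp add: pair_def W_def power2_eq_square)
  moreover have "of_int (fst w) \<noteq> (0::real) \<or> of_int (snd w) \<noteq> (0::real)" using assms(2) by (auto simp: prod_eq_iff)
  ultimately have "pair w W > 0" by (auto simp: add_pos_nonneg add_nonneg_pos)
  then have "pair w (c *\<^sub>R W) > 0" "pair w ((- c) *\<^sub>R W) < 0"
    using c by (simp_all only: pair_scaleR) (simp_all add: mult_neg_pos)
  moreover have "c *\<^sub>R W \<in> P" "(- c) *\<^sub>R W \<in> P"
    using c nW e by (auto simp: c_def dist_norm)
  ultimately show ?thesis using that by blast
qed

lemma fano_triangle_height_signs:
  assumes "fano_polygon (triangle v0 v1 v2)" "w \<noteq> (0, 0)"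
  shows "0 < max (idot w v0) (max (idot w v1) (idot w v2))"
    and "min (idot w v0) (min (idot w v1) (idot w v2)) < 0"
proof -
  obtain z1 z2 where z: "z1 \<in> triangle v0 v1 v2" "pair w z1 > 0" "z2 \<in> triangle v0 v1 v2" "pair w z2 < 0"
    using interior_pair_signs[OF fano_triangle(8)[OF assms(1)] assms(2)] .
  show "0 < max (idot w v0) (max (idot w v1) (idot w v2))"
    using triangle_pair_bounds(2)[OF z(1), of w] z(2) by linarith
  show "min (idot w v0) (min (idot w v1) (idot w v2)) < 0"
    using triangle_pair_bounds(1)[OF z(3), of w] z(4) by linarith
qed

lemma convex_hyper: "convex (hyper w h)"
  unfolding convex_def hyper_def
proof (clarify)
  fix x y :: pt and a b :: real
  assume "pair w x = of_int h" "pair w y = of_int h" "a + b = 1"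
  then show "pair w (a *\<^sub>R x + b *\<^sub>R y) = of_int h"
    by (simp add: pair_add pair_scaleR) (metis distrib_right mult_1)
qed

lemma slice_subset: "convex P \<Longrightarrow> slice w h P \<subseteq> P \<inter> hyper w h"
  unfolding slice_def by (rule hull_minimal) (auto intro: convex_Int convex_hyper)

lemma lat_in_slice: "lat v \<in> P \<Longrightarrow> idot w v = h \<Longrightarrow> lat v \<in> slice w h P"
  unfolding slice_def by (intro hull_inc) (simp add: hyper_def pair_lat)

lemma fano_triangle_vertices_eqI:
  assumes Q: "fano_polygon (triangle u0 u1 u2)"
    and "y0 extreme_point_of (triangle u0 u1 u2)" "y1 extreme_point_of (triangle u0 u1 u2)"
      "y2 extreme_point_of (triangle u0 u1 u2)"
    and "y0 \<noteq> y1" "y0 \<noteq> y2" "y1 \<noteq> y2"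
  shows "{lat u0, lat u1, lat u2} = {y0, y1, y2}"
proof -
  have V: "{x. x extreme_point_of (triangle u0 u1 u2)} = {lat u0, lat u1, lat u2}"
    using fano_triangle(4)[OF Q] unfolding vertices_def by simp
  then have "{y0, y1, y2} \<subseteq> {lat u0, lat u1, lat u2}" using assms(2-4) by blast
  moreover have "card {y0, y1, y2} = card {lat u0, lat u1, lat u2}"
    using assms(5-7) fano_triangle(1-3)[OF Q] by simp
  ultimately show ?thesis using card_subset_eq[of "{lat u0, lat u1, lat u2}" "{y0, y1, y2}"] by simp
qed

lemma in_mutation_neg:
  "y \<in> G h \<Longrightarrow> hmin w P \<le> of_int h \<Longrightarrow> h < 0 \<Longrightarrow> y \<in> mutation w P F G"
  unfolding mutation_def by (intro hull_inc) blast

lemma in_mutation_nonneg: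
  assumes "z \<in> slice w h P" "f \<in> F" "0 \<le> h" "of_int h \<le> hmax w P"
  shows "z + of_int h *\<^sub>R f \<in> mutation w P F G"
proof -
  have "z + of_int h *\<^sub>R f \<in> minkowski (slice w h P) ((*\<^sub>R) (of_int h) ` F)"
    unfolding minkowski_def using assms(1,2) by blast
  then show ?thesis unfolding mutation_def using assms(3,4) by (intro hull_inc) blast
qed

lemma mutation_subset:
  assumes "\<And>h y. hmin w P \<le> of_int h \<Longrightarrow> h < 0 \<Longrightarrow> y \<in> G h \<Longrightarrow> y \<in> T"
    and "\<And>h z f. 0 \<le> h \<Longrightarrow> of_int h \<le> hmax w P \<Longrightarrow> z \<in> slice w h P \<Longrightarrow> f \<in> F \<Longrightarrow>
      z + of_int h *\<^sub>R f \<in> T"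
    and "convex T"
  shows "mutation w P F G \<subseteq> T"
  unfolding mutation_def by (rule hull_minimal) (use assms in \<open>auto simp: minkowski_def\<close>)

lemma is_factorD:
  assumes "is_factor w P F G"
  shows "lattice_polytope F" "f \<in> F \<Longrightarrow> pair w f = 0"
    and "hmin w P \<le> of_int h \<Longrightarrow> h < 0 \<Longrightarrow> y \<in> G h \<Longrightarrow> pair w y = of_int h"
    and "hmin w P \<le> of_int h \<Longrightarrow> h < 0 \<Longrightarrow> v \<in> vertices P \<Longrightarrow> pair w v = of_int h \<Longrightarrow>
      \<exists>y f. y \<in> G h \<and> f \<in> F \<and> v = y + of_int (- h) *\<^sub>R f"
    and "hmin w P \<le> of_int h \<Longrightarrow> h < 0 \<Longrightarrow> y \<in> G h \<Longrightarrow> f \<in> F \<Longrightarrow>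
      y + of_int (- h) *\<^sub>R f \<in> slice w h P"
  using assms unfolding is_factor_def minkowski_def hyper_def by (blast, blast, blast, blast, blast)

lemma factor_lattice_point_idot: "is_factor w P F G \<Longrightarrow> lat g \<in> F \<Longrightarrow> idot w g = 0"
  using is_factorD(2) by (fastforce simp: pair_lat)

text \<open>A factor lies in the line \<open>w\<^sup>\<bottom>\<close>, on which \<open>cross u\<close> is an injective coordinate.\<close>
lemma factor_endpoints:
  assumes LF: "lattice_polytope F" and F0: "pair w ` F = {0}" and wu: "idot w u = 1"
  obtains ga gb where "lat ga \<in> F" "lat gb \<in> F"
    "\<And>z. z \<in> F \<Longrightarrow> of_int (icross u ga) \<le> cross u z \<and> cross u z \<le> of_int (icross u gb)"
    "ga = gb \<Longrightarrow> F = {lat ga}" "ga \<noteq> gb \<Longrightarrow> icross u ga < icross u gb"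
proof -
  obtain Fp where Fp: "finite Fp" "Fp \<subseteq> lattice_pts" "F = convex hull Fp"
    using LF unfolding lattice_polytope_def by blast
  have "Fp \<noteq> {}" using F0 Fp(3) by auto
  then have K: "finite (cross u ` Fp)" "cross u ` Fp \<noteq> {}" using Fp(1) by simp_all
  obtain ga where ga: "lat ga \<in> Fp" "cross u (lat ga) = Min (cross u ` Fp)"
    using Min_in[OF K] Fp(2) unfolding lattice_pts_def by auto
  obtain gb where gb: "lat gb \<in> Fp" "cross u (lat gb) = Max (cross u ` Fp)"
    using Max_in[OF K] Fp(2) unfolding lattice_pts_def by auto
  have F: "lat ga \<in> F" "lat gb \<in> F" using ga(1) gb(1) Fp(3) hull_inc by auto
  have pF: "pair w z = 0" if "z \<in> F" for z using F0 that by blast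
  have bounds: "cross u (lat ga) \<le> cross u z \<and> cross u z \<le> cross u (lat gb)" if "z \<in> F" for z
  proof -
    have z: "z \<in> convex hull Fp" using that Fp(3) by simp
    have "0 \<le> cross u z - cross u (lat ga)"
      by (rule affine_fn_nonneg_convex_hull[OF affine_fn_diff[OF affine_fn_cross affine_fn_const] _ z])
        (use K(1) ga in simp)
    moreover have "0 \<le> cross u (lat gb) - cross u z"
      by (rule affine_fn_nonneg_convex_hull[OF affine_fn_diff[OF affine_fn_const affine_fn_cross] _ z])
        (use K(1) gb in simp)
    ultimately show ?thesis by simp
  qed
  have same: "z = z'" if "z \<in> F" "z' \<in> F" "cross u z = cross u z'" for z z'
    by (rule eq_if_pair_cross_eq[OF wu]) (simp_all add: pF that)
  show ?thesis
  proof (rule that[OF F])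
    show "of_int (icross u ga) \<le> cross u z \<and> cross u z \<le> of_int (icross u gb)" if "z \<in> F" for z
      using bounds[OF that] by (simp add: cross_lat)
    show "F = {lat ga}" if "ga = gb"
    proof -
      have "z = lat ga" if "z \<in> F" for z
        using same[OF that F(1)] bounds[OF that] \<open>ga = gb\<close> by simp
      then show ?thesis using F(1) by blast
    qed
    show "icross u ga < icross u gb" if "ga \<noteq> gb"
    proof -
      have "icross u ga \<noteq> icross u gb" using same[OF F] that by (auto simp: cross_lat)
      moreover have "icross u ga \<le> icross u gb" using bounds[OF F(2)] by (simp add: cross_lat)
      ultimately show ?thesis by simp
    qed
  qed
qed

section \<open>Invariance of the index under mutation\<close>

definition shear :: "int \<times> int \<Rightarrow> int \<times> int \<Rightarrow> pt \<Rightarrow> pt" where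
  "shear w g z = z + pair w z *\<^sub>R lat g"

lemma linear_shear: "linear (shear w g)"
  unfolding shear_def by (rule linearI) (simp_all add: pair_add pair_scaleR algebra_simps)

lemma shear_lat: "shear w g (lat v) = lat (int_shear w g v)"
  by (simp add: shear_def int_shear_def lat_def pair_def idot_def algebra_simps)

lemma triangle_linear_image:
  assumes "linear f" "\<And>v. f (lat v) = lat (h v)"
  shows "f ` triangle v0 v1 v2 = triangle (h v0) (h v1) (h v2)"
  unfolding triangle_def by (simp add: convex_hull_linear_image[OF assms(1)] assms(2))

lemma triangle_eq_imp_vertices_eq:
  assumes "0 \<in> interior (triangle u0 u1 u2)" "triangle u0 u1 u2 = triangle x0 x1 x2"
  shows "{u0, u1, u2} = {x0, x1, x2}"
proof -
  have "0 \<in> interior (triangle x0 x1 x2)" using assms by simp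
  then have "{lat x0, lat x1, lat x2} = {lat u0, lat u1, lat u2}"
    using extreme_points_triangle(4) assms unfolding triangle_def by metis
  then show ?thesis by (simp add: lat_image_eq_iff)
qed

lemma mutation_point_factor:
  assumes P: "fano_polygon (triangle v0 v1 v2)"
    and fac: "is_factor w (triangle v0 v1 v2) {lat g} G"
  shows "mutation w (triangle v0 v1 v2) {lat g} G = shear w g ` triangle v0 v1 v2"
proof
  let ?P = "triangle v0 v1 v2"
  have cP: "convex ?P" unfolding triangle_def by simp
  have pg: "pair w (lat g) = 0" using is_factorD(2)[OF fac] by simp
  show "mutation w ?P {lat g} G \<subseteq> shear w g ` ?P"
  proof (rule mutation_subset)
    show "convex (shear w g ` ?P)" by (rule convex_linear_image[OF linear_shear cP])
  next
    fix h y assume h: "hmin w ?P \<le> of_int h" "h < 0" and y: "y \<in> G h"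
    have "y + of_int (- h) *\<^sub>R lat g \<in> ?P"
      using is_factorD(5)[OF fac h y] slice_subset[OF cP] by blast
    moreover have "shear w g (y + of_int (- h) *\<^sub>R lat g) = y"
      using is_factorD(3)[OF fac h y] by (simp add: shear_def pair_add pair_diff pair_scaleR pg)
    ultimately show "y \<in> shear w g ` ?P" by (metis image_eqI)
  next
    fix h z f assume "0 \<le> h" "of_int h \<le> hmax w ?P" and z: "z \<in> slice w h ?P" and "f \<in> {lat g}"
    moreover have "z \<in> ?P \<inter> hyper w h" using z slice_subset[OF cP] by blast
    ultimately have "z \<in> ?P" "z + of_int h *\<^sub>R f = shear w g z" by (simp_all add: shear_def hyper_def)
    then show "z + of_int h *\<^sub>R f \<in> shear w g ` ?P" by simp
  qed
  have "shear w g (lat v) \<in> mutation w ?P {lat g} G" if v: "lat v \<in> vertices ?P" for v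
  proof -
    have vP: "lat v \<in> ?P" using v unfolding vertices_def by (auto simp: extreme_point_of_def)
    have bounds: "hmin w ?P \<le> of_int (idot w v)" "of_int (idot w v) \<le> hmax w ?P"
      using triangle_pair_bounds[OF vP, of w] unfolding triangle_hmin_hmax by (simp_all add: pair_lat)
    show ?thesis
    proof (cases "idot w v < 0")
      case True
      have "pair w (lat v) = of_int (idot w v)" by (rule pair_lat)
      then obtain y f where y: "y \<in> G (idot w v)" "f \<in> {lat g}" "lat v = y + of_int (- idot w v) *\<^sub>R f"
        using is_factorD(4)[OF fac bounds(1) True v] by blast
      have "shear w g (lat v) = lat v + of_int (idot w v) *\<^sub>R lat g" by (simp add: shear_def pair_lat)
      also have "\<dots> = y" using y(2,3) by simp
      finally show ?thesis using in_mutation_neg[of y G "idot w v", OF y(1) bounds(1) True] by simp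
    next
      case False
      then show ?thesis
        using in_mutation_nonneg[OF lat_in_slice[OF vP refl] _ _ bounds(2)]
        by (simp add: shear_def pair_lat)
    qed
  qed
  then have "shear w g ` {lat v0, lat v1, lat v2} \<subseteq> mutation w ?P {lat g} G"
    using fano_triangle(4)[OF P] by blast
  moreover have "convex (mutation w ?P {lat g} G)" unfolding mutation_def by simp
  ultimately show "shear w g ` ?P \<subseteq> mutation w ?P {lat g} G"
    unfolding triangle_def convex_hull_linear_image[OF linear_shear] by (rule hull_minimal)
qed

lemma mult_mutation_point_factor:
  assumes P: "fano_polygon (triangle v0 v1 v2)" and Q: "fano_polygon (triangle u0 u1 u2)"
    and fac: "is_factor w (triangle v0 v1 v2) {lat g} G" and det: "\<bar>a * d - b * c\<bar> = 1"
    and Qe: "triangle u0 u1 u2 = real_lin a b c d ` mutation w (triangle v0 v1 v2) {lat g} G"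
  shows "mult v0 v1 v2 = mult u0 u1 u2"
proof -
  let ?x = "\<lambda>v. int_lin a b c d (int_shear w g v)"
  have "triangle u0 u1 u2 = real_lin a b c d ` shear w g ` triangle v0 v1 v2"
    using Qe mutation_point_factor[OF P fac] by simp
  also have "\<dots> = triangle (?x v0) (?x v1) (?x v2)"
    by (simp add: triangle_linear_image linear_shear shear_lat linear_real_lin real_lin_lat)
  finally have "{u0, u1, u2} = {?x v0, ?x v1, ?x v2}"
    using triangle_eq_imp_vertices_eq fano_triangle(8)[OF Q] by blast
  then have "mult u0 u1 u2 = mult (?x v0) (?x v1) (?x v2)" by (rule mult_eq_if_vertices_eq)
  also have "\<dots> = mult v0 v1 v2"
    using mult_int_lin[OF det] mult_int_shear factor_lattice_point_idot[OF fac] by simp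
  finally show ?thesis by simp
qed

lemma triangle_unique_lowest_point:
  assumes z: "z \<in> triangle v0 v1 v2" "pair w z = of_int (idot w v0)"
    and low: "idot w v0 < idot w v1" "idot w v0 < idot w v2"
  shows "z = lat v0"
proof -
  obtain a b c where abc: "0 \<le> a" "0 \<le> b" "0 \<le> c" "a + b + c = 1"
    "z = a *\<^sub>R lat v0 + b *\<^sub>R lat v1 + c *\<^sub>R lat v2"
    using triangle_barycentric[OF z(1)] by blast
  have a: "a = 1 - b - c" using abc(4) by simp
  have "b * of_int (idot w v1 - idot w v0) + c * of_int (idot w v2 - idot w v0) = 0"
    using z(2) unfolding abc(5) a by (simp only: pair_add pair_scaleR pair_lat) (simp add: algebra_simps)
  moreover have "b * of_int (idot w v1 - idot w v0) \<ge> 0" "c * of_int (idot w v2 - idot w v0) \<ge> 0"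
    using abc(2,3) low by simp_all
  ultimately have "b = 0" "c = 0" using low by (simp_all add: add_nonneg_eq_0_iff)
  then show ?thesis using abc(4,5) by simp
qed

text \<open>If a single vertex lies at the minimal (negative) height, it is the Minkowski sum of
  \<open>G\<^sub>h\<close> with \<open>-h F\<close> inside a slice that is just that vertex, so \<open>F\<close> has a single lattice point.\<close>
lemma factor_single_point_if_lowest_vertex_unique:
  assumes fac: "is_factor w (triangle v0 v1 v2) F G"
    and V: "lat v0 \<in> vertices (triangle v0 v1 v2)"
    and low: "idot w v0 < idot w v1" "idot w v0 < idot w v2" "idot w v0 < 0"
    and F: "lat ga \<in> F" "lat gb \<in> F"
  shows "ga = gb"
proof -
  let ?P = "triangle v0 v1 v2" and ?h = "idot w v0"
  have cP: "convex ?P" unfolding triangle_def by simp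
  have hmin: "hmin w ?P \<le> of_int ?h" using low by (simp add: triangle_hmin_hmax)
  obtain y f where y: "y \<in> G ?h"
    using is_factorD(4)[OF fac hmin low(3) V] by (auto simp: pair_lat)
  have eq: "y + of_int (- ?h) *\<^sub>R lat g = lat v0" if "lat g \<in> F" for g
  proof (rule triangle_unique_lowest_point[OF _ _ low(1,2)])
    have "y + of_int (- ?h) *\<^sub>R lat g \<in> ?P \<inter> hyper w ?h"
      using is_factorD(5)[OF fac hmin low(3) y that] slice_subset[OF cP] by blast
    then show "y + of_int (- ?h) *\<^sub>R lat g \<in> ?P" "pair w (y + of_int (- ?h) *\<^sub>R lat g) = of_int ?h"
      by (simp_all add: hyper_def)
  qed
  have "y + of_int (- ?h) *\<^sub>R lat ga = y + of_int (- ?h) *\<^sub>R lat gb"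
    by (simp only: eq[OF F(1)] eq[OF F(2)])
  then have "lat ga = lat gb" using low(3) by simp
  then show "ga = gb" by simp
qed

text \<open>The main case: \<open>v\<^sub>0\<close> is the top vertex, the edge \<open>v\<^sub>1 v\<^sub>2\<close> lies at height \<open>-r\<close>, and the
  factor is the lattice segment \<open>[g\<^sub>a, g\<^sub>b]\<close> in \<open>w\<^sup>\<bottom>\<close>. In the coordinates \<open>(pair w, cross u)\<close> the
  mutation lies in the quadrilateral \<open>T\<close> cut out by the two heights and by the sides through
  \<open>v\<^sub>0\<close> sheared by \<open>g\<^sub>a\<close> resp. \<open>g\<^sub>b\<close>, and the four corners \<open>p\<^sub>1, p\<^sub>2, q\<^sub>3, q\<^sub>4\<close> of \<open>T\<close> lie in
  the mutation.\<close>
locale edge_factor =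
  fixes v0 v1 v2 w u ga gb :: "int \<times> int" and H r :: int and F :: "pt set" and G :: "int \<Rightarrow> pt set"
  assumes P: "fano_polygon (triangle v0 v1 v2)"
    and fac: "is_factor w (triangle v0 v1 v2) F G"
    and wu: "idot w u = 1"
    and top: "idot w v0 = H" "H > 0"
    and bottom: "idot w v1 = - r" "idot w v2 = - r" "r > 0"
    and order: "icross u v1 < icross u v2"
    and ends: "lat ga \<in> F" "lat gb \<in> F" "icross u ga < icross u gb"
    and between: "\<And>z. z \<in> F \<Longrightarrow> of_int (icross u ga) \<le> cross u z \<and> cross u z \<le> of_int (icross u gb)"
begin

abbreviation "P \<equiv> triangle v0 v1 v2"
abbreviation "R \<equiv> mutation w P F G"

text \<open>\<open>side1\<close> and \<open>side2\<close> vanish on the lines \<open>v\<^sub>1 v\<^sub>0\<close> resp. \<open>v\<^sub>2 v\<^sub>0\<close>; \<open>edge1\<close> and \<open>edge2\<close> are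
  the same functionals after shearing by \<open>g\<^sub>a\<close> resp. \<open>g\<^sub>b\<close>.\<close>
definition side1 :: "pt \<Rightarrow> real" where
  "side1 z = (cross u z - of_int (icross u v1)) * of_int (H + r)
    - of_int (icross u v0 - icross u v1) * (pair w z + of_int r)"

definition side2 :: "pt \<Rightarrow> real" where
  "side2 z = (of_int (icross u v2) - cross u z) * of_int (H + r)
    - of_int (icross u v2 - icross u v0) * (pair w z + of_int r)"

definition edge1 :: "pt \<Rightarrow> real" where
  "edge1 z = side1 z - pair w z * of_int (icross u ga) * of_int (H + r)"

definition edge2 :: "pt \<Rightarrow> real" where
  "edge2 z = side2 z + pair w z * of_int (icross u gb) * of_int (H + r)"

definition low :: "pt \<Rightarrow> real" where "low z = pair w z + of_int r"

definition high :: "pt \<Rightarrow> real" where "high z = of_int H - pair w z"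

definition T :: "pt set" where
  "T = {z. 0 \<le> low z \<and> 0 \<le> high z \<and> 0 \<le> edge1 z \<and> 0 \<le> edge2 z}"

definition p1 :: "int \<times> int" where "p1 = (fst v1 - r * fst ga, snd v1 - r * snd ga)"
definition p2 :: "int \<times> int" where "p2 = (fst v2 - r * fst gb, snd v2 - r * snd gb)"
definition q3 :: "int \<times> int" where "q3 = (fst v0 + H * fst ga, snd v0 + H * snd ga)"
definition q4 :: "int \<times> int" where "q4 = (fst v0 + H * fst gb, snd v0 + H * snd gb)"

lemma affine_fns: "affine_fn side1" "affine_fn side2" "affine_fn edge1" "affine_fn edge2"
    "affine_fn low" "affine_fn high"
  unfolding side1_def side2_def edge1_def edge2_def low_def high_def
  by (intro affine_fn_intros)+

lemma idot_ends: "idot w ga = 0" "idot w gb = 0"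
  using factor_lattice_point_idot[OF fac] ends by blast+

lemma side_shift:
  assumes "pair w f = 0"
  shows "side1 (z + c *\<^sub>R f) = side1 z + c * cross u f * of_int (H + r)"
    and "side2 (z + c *\<^sub>R f) = side2 z - c * cross u f * of_int (H + r)"
  using assms by (simp_all add: side1_def side2_def pair_add pair_scaleR cross_add cross_scaleR algebra_simps)

lemma side_vertices:
  "side1 (lat v0) = 0" "side1 (lat v1) = 0" "side1 (lat v2) = of_int (icross u v2 - icross u v1) * of_int (H + r)"
  "side2 (lat v0) = 0" "side2 (lat v2) = 0" "side2 (lat v1) = of_int (icross u v2 - icross u v1) * of_int (H + r)"
  using top bottom by (simp_all add: side1_def side2_def pair_lat cross_lat algebra_simps)

lemma side_nonneg:
  assumes "z \<in> P"
  shows "0 \<le> side1 z" "0 \<le> side2 z"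
proof -
  have "0 \<le> of_int (icross u v2 - icross u v1) * real_of_int (H + r)" using order top bottom by simp
  then show "0 \<le> side1 z" "0 \<le> side2 z"
    using affine_fn_nonneg_triangle[OF affine_fns(1) _ _ _ assms]
      affine_fn_nonneg_triangle[OF affine_fns(2) _ _ _ assms] by (simp_all add: side_vertices)
qed

lemma mutation_subset_T: "R \<subseteq> T"
proof (rule mutation_subset)
  show "convex T" unfolding T_def
    using convex_affine_fn_nonneg[OF affine_fns(5)] convex_affine_fn_nonneg[OF affine_fns(6)]
      convex_affine_fn_nonneg[OF affine_fns(3)] convex_affine_fn_nonneg[OF affine_fns(4)]
    by (simp add: Collect_conj_eq convex_Int)
  have cP: "convex P" unfolding triangle_def by simp
  have hm: "hmin w P = - of_int r" "hmax w P = of_int H"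
    using top bottom by (simp_all add: triangle_hmin_hmax)
  have pg: "pair w (lat ga) = 0" "pair w (lat gb) = 0" using idot_ends by (simp_all add: pair_lat)
  fix h y assume h: "hmin w P \<le> of_int h" "h < 0" and y: "y \<in> G h"
  have py: "pair w y = of_int h" by (rule is_factorD(3)[OF fac h y])
  have "y + of_int (- h) *\<^sub>R lat g \<in> P" if "lat g \<in> F" for g
    using is_factorD(5)[OF fac h y that] slice_subset[OF cP] by blast
  then have "0 \<le> side1 (y + of_int (- h) *\<^sub>R lat ga)" "0 \<le> side2 (y + of_int (- h) *\<^sub>R lat gb)"
    using side_nonneg ends by blast+
  moreover have "edge1 y = side1 (y + of_int (- h) *\<^sub>R lat ga)" "edge2 y = side2 (y + of_int (- h) *\<^sub>R lat gb)"
    unfolding side_shift[OF pg(1)] side_shift[OF pg(2)] edge1_def edge2_def using py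
    by (simp_all add: cross_lat)
  moreover have "0 \<le> low y" "0 \<le> high y" using h hm py top by (simp_all add: low_def high_def)
  ultimately show "y \<in> T" by (simp add: T_def)
next
  have hm: "hmax w P = of_int H" using top bottom by (simp add: triangle_hmin_hmax)
  fix h z f assume h: "0 \<le> h" "of_int h \<le> hmax w P" and z: "z \<in> slice w h P" and f: "f \<in> F"
  have cP: "convex P" unfolding triangle_def by simp
  have "z \<in> P \<inter> hyper w h" using z slice_subset[OF cP] by blast
  then have zP: "z \<in> P" and pz: "pair w z = of_int h" by (auto simp: hyper_def)
  have pf: "pair w f = 0" using is_factorD(2)[OF fac f] .
  have "0 \<le> of_int h * (cross u f - of_int (icross u ga)) * of_int (H + r)"
    "0 \<le> of_int h * (of_int (icross u gb) - cross u f) * of_int (H + r)"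
    using between[OF f] h top bottom by simp_all
  then show "z + of_int h *\<^sub>R f \<in> T"
    using side_nonneg[OF zP] h hm pz pf bottom
    by (simp add: T_def edge1_def edge2_def low_def high_def side_shift pair_add pair_scaleR algebra_simps)
qed

lemma corners_lat:
  "lat p1 = lat v1 + of_int (- r) *\<^sub>R lat ga" "lat p2 = lat v2 + of_int (- r) *\<^sub>R lat gb"
  "lat q3 = lat v0 + of_int H *\<^sub>R lat ga" "lat q4 = lat v0 + of_int H *\<^sub>R lat gb"
  by (simp_all add: lat_def p1_def p2_def q3_def q4_def)

lemma corner_zeros:
  "low (lat p1) = 0" "edge1 (lat p1) = 0" "low (lat p2) = 0" "edge2 (lat p2) = 0"
  "high (lat q3) = 0" "edge1 (lat q3) = 0" "high (lat q4) = 0" "edge2 (lat q4) = 0"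
proof -
  have pg: "pair w (lat ga) = 0" "pair w (lat gb) = 0" using idot_ends by (simp_all add: pair_lat)
  show "low (lat p1) = 0" "low (lat p2) = 0" "high (lat q3) = 0" "high (lat q4) = 0"
    unfolding corners_lat using top bottom pg by (simp_all add: low_def high_def pair_add pair_diff pair_scaleR pair_lat)
  show "edge1 (lat p1) = 0" "edge2 (lat p2) = 0" "edge1 (lat q3) = 0" "edge2 (lat q4) = 0"
    unfolding corners_lat edge1_def edge2_def side_shift[OF pg(1)] side_shift[OF pg(2)] side_vertices
    using top bottom pg by (simp_all add: pair_add pair_diff pair_scaleR pair_lat cross_lat algebra_simps)
qed

lemma edge_determines:
  assumes "pair w x = pair w y"
  shows "edge1 x = edge1 y \<Longrightarrow> x = y" and "edge2 x = edge2 y \<Longrightarrow> x = y"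
proof -
  have "edge1 x - edge1 y = (cross u x - cross u y) * of_int (H + r)"
    "edge2 y - edge2 x = (cross u x - cross u y) * of_int (H + r)"
    using assms by (simp_all add: edge1_def edge2_def side1_def side2_def algebra_simps)
  moreover have "real_of_int (H + r) \<noteq> 0" using top bottom by simp
  ultimately show "edge1 x = edge1 y \<Longrightarrow> x = y" "edge2 x = edge2 y \<Longrightarrow> x = y"
    using eq_if_pair_cross_eq[OF wu assms] by simp_all
qed

lemma corners_in_mutation: "lat p1 \<in> R" "lat p2 \<in> R" "lat q3 \<in> R" "lat q4 \<in> R"
proof -
  have hm: "hmin w P = - of_int r" "hmax w P = of_int H"
    using top bottom by (simp_all add: triangle_hmin_hmax)
  have "lat v0 \<in> slice w H P" using lat_in_slice lat_in_triangle top by blast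
  then show "lat q3 \<in> R" "lat q4 \<in> R"
    unfolding corners_lat using in_mutation_nonneg ends top(2) hm by (simp_all add: less_imp_le)
  have hr: "hmin w P \<le> of_int (- r)" "- r < 0" using hm bottom by simp_all
  have V: "lat v1 \<in> vertices P" "lat v2 \<in> vertices P" using fano_triangle(4)[OF P] by simp_all
  have "pair w (lat v1) = of_int (- r)" "pair w (lat v2) = of_int (- r)"
    using bottom by (simp_all add: pair_lat)
  then obtain y1 f1 y2 f2 where y1: "y1 \<in> G (- r)" "f1 \<in> F" "lat v1 = y1 + of_int (- (- r)) *\<^sub>R f1"
    and y2: "y2 \<in> G (- r)" "f2 \<in> F" "lat v2 = y2 + of_int (- (- r)) *\<^sub>R f2"
    using is_factorD(4)[OF fac hr V(1)] is_factorD(4)[OF fac hr V(2)] by meson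
  have R: "y1 \<in> R" "y2 \<in> R" using in_mutation_neg[of _ G "- r", OF _ hr] y1(1) y2(1) by blast+
  then have "0 \<le> edge1 y1" "0 \<le> edge2 y2" using mutation_subset_T by (auto simp: T_def)
  moreover have "edge1 y1 = of_int r * (of_int (icross u ga) - cross u f1) * of_int (H + r)"
    "edge2 y2 = of_int r * (cross u f2 - of_int (icross u gb)) * of_int (H + r)"
  proof -
    have yeq: "y1 = lat v1 + of_int (- r) *\<^sub>R f1" "y2 = lat v2 + of_int (- r) *\<^sub>R f2"
      using y1(3) y2(3) by (simp_all add: algebra_simps)
    have pf: "pair w f1 = 0" "pair w f2 = 0" using is_factorD(2)[OF fac] y1(2) y2(2) by blast+
    show "edge1 y1 = of_int r * (of_int (icross u ga) - cross u f1) * of_int (H + r)"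
      unfolding yeq edge1_def side_shift[OF pf(1)] using bottom pf
      by (simp add: side_vertices pair_add pair_diff pair_scaleR pair_lat algebra_simps)
    show "edge2 y2 = of_int r * (cross u f2 - of_int (icross u gb)) * of_int (H + r)"
      unfolding yeq edge2_def side_shift[OF pf(2)] using bottom pf
      by (simp add: side_vertices pair_add pair_diff pair_scaleR pair_lat algebra_simps)
  qed
  moreover have "of_int (icross u ga) \<le> cross u f1" "cross u f2 \<le> of_int (icross u gb)"
    using between y1(2) y2(2) by blast+
  ultimately have "edge1 y1 = 0" "edge2 y2 = 0" using top bottom
    by (simp_all add: zero_le_mult_iff mult_le_0_iff)
  moreover have "pair w y1 = pair w (lat p1)" "pair w y2 = pair w (lat p2)"
    using is_factorD(3)[OF fac hr] y1(1) y2(1) corner_zeros by (simp_all add: low_def)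
  ultimately have "y1 = lat p1" "y2 = lat p2" using edge_determines corner_zeros by simp_all
  then show "lat p1 \<in> R" "lat p2 \<in> R" using R by simp_all
qed

lemma extreme_corner:
  assumes "c \<in> T" and k: "k = low \<or> k = high" and e: "e = edge1 \<or> e = edge2"
    and zero: "k c = 0" "e c = 0"
  shows "c extreme_point_of T"
proof (rule extreme_point_by_affine_fns[OF assms(1), of k e])
  show "affine_fn k" "affine_fn e" using k e affine_fns by auto
  show "0 \<le> k x" "0 \<le> e x" if "x \<in> T" for x using that k e by (auto simp: T_def)
  show "k c = 0" "e c = 0" by (fact zero)+
  show "x = c" if "x \<in> T" "k x = 0" "e x = 0" for x
  proof -
    have "pair w x = pair w c" using k that(2) zero(1) by (auto simp: low_def high_def)
    moreover have "e x = e c" using that(3) zero(2) by simp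
    ultimately show ?thesis using e edge_determines by blast
  qed
qed

lemma corners_extreme:
  "lat p1 extreme_point_of R" "lat p2 extreme_point_of R" "lat q3 extreme_point_of R" "lat q4 extreme_point_of R"
proof -
  have T: "lat p1 \<in> T" "lat p2 \<in> T" "lat q3 \<in> T" "lat q4 \<in> T"
    using corners_in_mutation mutation_subset_T by blast+
  have "lat p1 extreme_point_of T" "lat p2 extreme_point_of T" "lat q3 extreme_point_of T"
    "lat q4 extreme_point_of T"
    using extreme_corner[OF T(1), of low edge1] extreme_corner[OF T(2), of low edge2]
      extreme_corner[OF T(3), of high edge1] extreme_corner[OF T(4), of high edge2]
    by (simp_all add: corner_zeros)
  then show "lat p1 extreme_point_of R" "lat p2 extreme_point_of R" "lat q3 extreme_point_of R"
    "lat q4 extreme_point_of R"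
    using extreme_point_of_subset[OF _ corners_in_mutation(1) mutation_subset_T]
      extreme_point_of_subset[OF _ corners_in_mutation(2) mutation_subset_T]
      extreme_point_of_subset[OF _ corners_in_mutation(3) mutation_subset_T]
      extreme_point_of_subset[OF _ corners_in_mutation(4) mutation_subset_T] by blast+
qed

lemma corners_distinct: "q3 \<noteq> q4" "p1 \<noteq> q3" "p1 \<noteq> q4" "p2 \<noteq> q3" "p2 \<noteq> q4"
proof -
  have "idot w p1 = - r" "idot w p2 = - r" "idot w q3 = H" "idot w q4 = H"
    using top bottom idot_ends idot_add_scaled[of w _ "- r"] by (simp_all add: p1_def p2_def q3_def q4_def idot_add_scaled)
  then show "p1 \<noteq> q3" "p1 \<noteq> q4" "p2 \<noteq> q3" "p2 \<noteq> q4" using top bottom by auto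
  have "icross u q4 - icross u q3 = H * (icross u gb - icross u ga)"
    by (simp add: icross_def q3_def q4_def algebra_simps)
  then show "q3 \<noteq> q4" using top ends(3) by auto
qed

text \<open>The image of the mutation is a triangle, so two of the four corners must coincide.\<close>
lemma mutation_vertices:
  assumes Q: "fano_polygon (triangle u0 u1 u2)" and det: "\<bar>a * d - b * c\<bar> = 1"
    and Qe: "triangle u0 u1 u2 = real_lin a b c d ` R"
  shows "p1 = p2" and "{u0, u1, u2} = {int_lin a b c d p1, int_lin a b c d q3, int_lin a b c d q4}"
proof -
  let ?L = "\<lambda>p. real_lin a b c d (lat p)"
  have ext: "?L p1 extreme_point_of triangle u0 u1 u2" "?L p2 extreme_point_of triangle u0 u1 u2"
    "?L q3 extreme_point_of triangle u0 u1 u2" "?L q4 extreme_point_of triangle u0 u1 u2"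
    unfolding Qe using extreme_point_of_real_lin_image[OF det] corners_extreme by blast+
  have inj: "?L p = ?L q \<longleftrightarrow> p = q" for p q
    using inj_real_lin[OF det] by (simp add: inj_eq)
  have V: "{x. x extreme_point_of triangle u0 u1 u2} = {lat u0, lat u1, lat u2}"
    using fano_triangle(4)[OF Q] unfolding vertices_def by simp
  show "p1 = p2"
  proof (rule ccontr)
    assume "p1 \<noteq> p2"
    then have "card {?L p1, ?L p2, ?L q3, ?L q4} = 4" using corners_distinct by (simp add: inj)
    moreover have "{?L p1, ?L p2, ?L q3, ?L q4} \<subseteq> {lat u0, lat u1, lat u2}" using ext V by blast
    then have "card {?L p1, ?L p2, ?L q3, ?L q4} \<le> card {lat u0, lat u1, lat u2}" by (simp add: card_mono)
    moreover have "card {lat u0, lat u1, lat u2} \<le> 3" by (simp add: card_insert_if)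
    ultimately show False by simp
  qed
  have "{lat u0, lat u1, lat u2} = {?L p1, ?L q3, ?L q4}"
    using fano_triangle_vertices_eqI[OF Q ext(1,3,4)] corners_distinct by (simp add: inj)
  then show "{u0, u1, u2} = {int_lin a b c d p1, int_lin a b c d q3, int_lin a b c d q4}"
    by (simp add: real_lin_lat lat_image_eq_iff)
qed

end

lemma edge_lattice_coeffs:
  fixes L0 L1 L2 H r \<kappa> x y x' y' p q D :: int
  assumes "L2 * r * D = - L0 * q - (L1 + L2) * p" "L2 * H * D = - (L1 + L2) * q - \<kappa> * p"
    "L0 * H = (L1 + L2) * r" "x * L2 + y * L0 = 1" "x' * L2 + y' * (L1 + L2) = 1"
  shows "q + H * D = (1 - x * (L1 + L2)) * q + (- x * \<kappa> - y * (L1 + L2)) * p + y * (L1 + L2) * (p + r * D)"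
    and "p + r * D = (1 - x' * (L1 + L2)) * p + (- x' * L0 - y' * L0) * q + y' * L0 * (q + H * D)"
  using assms by algebra+

text \<open>The two relations express \<open>\<lambda>\<^sub>2 r D\<close> and \<open>\<lambda>\<^sub>2 H D\<close> through \<open>p, q\<close>; Bezout for \<open>\<lambda>\<^sub>2\<close>
  against \<open>\<lambda>\<^sub>0\<close> and against \<open>\<lambda>\<^sub>1 + \<lambda>\<^sub>2\<close> removes the factor \<open>\<lambda>\<^sub>2\<close>.\<close>
lemma sublattice_edge_mutation:
  fixes p q D :: "int \<times> int" and L0 L1 L2 H r \<kappa> :: int
  assumes X1: "L2 * r * fst D = - L0 * fst q - (L1 + L2) * fst p"
      "L2 * r * snd D = - L0 * snd q - (L1 + L2) * snd p"
    and XK: "L2 * H * fst D = - (L1 + L2) * fst q - \<kappa> * fst p"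
      "L2 * H * snd D = - (L1 + L2) * snd q - \<kappa> * snd p"
    and E: "L0 * H = (L1 + L2) * r"
    and cop: "coprime L2 L0" "coprime L2 (L1 + L2)"
  shows "sublattice p q (fst q + H * fst D, snd q + H * snd D) = sublattice q p (fst p + r * fst D, snd p + r * snd D)"
proof -
  obtain x y x' y' where b: "x * L2 + y * L0 = 1" "x' * L2 + y' * (L1 + L2) = 1"
    using cop by (metis bezout_int coprime_iff_gcd_eq_1)
  note fst_eqs = edge_lattice_coeffs[OF X1(1) XK(1) E b]
  note snd_eqs = edge_lattice_coeffs[OF X1(2) XK(2) E b]
  show ?thesis
  proof (rule sublattice_eqI)
    show "p \<in> sublattice q p (fst p + r * fst D, snd p + r * snd D)"
      "q \<in> sublattice q p (fst p + r * fst D, snd p + r * snd D)"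
      "q \<in> sublattice p q (fst q + H * fst D, snd q + H * snd D)"
      "p \<in> sublattice p q (fst q + H * fst D, snd q + H * snd D)"
      using sublattice_generators by auto
    show "(fst q + H * fst D, snd q + H * snd D) \<in> sublattice q p (fst p + r * fst D, snd p + r * snd D)"
      unfolding sublattice_iff using fst_eqs(1) snd_eqs(1) by auto
    show "(fst p + r * fst D, snd p + r * snd D) \<in> sublattice p q (fst q + H * fst D, snd q + H * snd D)"
      unfolding sublattice_iff using fst_eqs(2) snd_eqs(2) by auto
  qed
qed

lemma primitive_int_lin_imp: "primitive (int_lin a b c d p) \<Longrightarrow> primitive p"
proof -
  assume prim: "primitive (int_lin a b c d p)"
  have "gcd (fst p) (snd p) dvd gcd (fst (int_lin a b c d p)) (snd (int_lin a b c d p))"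
    by (rule gcd_greatest) (simp_all add: int_lin_def)
  also have "\<dots> = 1" using prim unfolding primitive_def .
  finally have "\<bar>gcd (fst p) (snd p)\<bar> = 1" by (simp only: zdvd1_eq)
  then show "primitive p" unfolding primitive_def by simp
qed

lemma dvd_if_dvd_primitive_multiple:
  fixes L n :: int
  assumes "primitive p" "L dvd n * fst p" "L dvd n * snd p"
  shows "L dvd n"
proof -
  have "L dvd gcd (n * fst p) (n * snd p)" using assms(2,3) by simp
  also have "gcd (n * fst p) (n * snd p) = \<bar>n\<bar>" using assms(1) by (simp add: gcd_mult_left primitive_def)
  finally show ?thesis by simp
qed

context edge_factor
begin

lemma weight_height_relation:
  assumes "fwpp_weights v0 v1 v2 l0 l1 l2"
  shows "int l0 * H = (int l1 + int l2) * r"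
proof -
  have "int l0 * idot w v0 + int l1 * idot w v1 + int l2 * idot w v2 =
      fst w * (int l0 * fst v0 + int l1 * fst v1 + int l2 * fst v2)
      + snd w * (int l0 * snd v0 + int l1 * snd v1 + int l2 * snd v2)"
    by (simp add: idot_def algebra_simps)
  also have "\<dots> = 0" using assms unfolding fwpp_weights_def by simp
  finally show ?thesis using top bottom by (simp add: algebra_simps)
qed

text \<open>Shearing by \<open>g\<^sub>a\<close> maps \<open>v\<^sub>0, v\<^sub>1, v\<^sub>2\<close> to \<open>q\<^sub>3, p\<^sub>1, p\<^sub>1 + r (g\<^sub>b - g\<^sub>a)\<close>; the weight relation
  and the primitivity of \<open>p\<^sub>1\<close> (which forces \<open>\<lambda>\<^sub>0 | (\<lambda>\<^sub>1 + \<lambda>\<^sub>2)\<^sup>2\<close>) give the index equality.\<close>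
lemma mult_corners:
  assumes wX: "fwpp_weights v0 v1 v2 l0 l1 l2" and cop: "coprime l0 l2" "coprime l1 l2"
    and p12: "p1 = p2" and prim: "primitive p1"
  shows "mult p1 q3 q4 = mult v0 v1 v2"
proof -
  define L0 L1 L2 where "L0 = int l0" and "L1 = int l1" and "L2 = int l2"
  define D where "D = (fst gb - fst ga, snd gb - snd ga)"
  have W: "L0 * fst v0 + L1 * fst v1 + L2 * fst v2 = 0" "L0 * snd v0 + L1 * snd v1 + L2 * snd v2 = 0"
    and L0: "L0 > 0" using wX unfolding fwpp_weights_def L0_def L1_def L2_def by auto
  have E: "L0 * H = (L1 + L2) * r"
    using weight_height_relation[OF wX] by (simp add: L0_def L1_def L2_def)
  have p: "p1 = (fst v1 - r * fst ga, snd v1 - r * snd ga)" "p1 = (fst v2 - r * fst gb, snd v2 - r * snd gb)"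
    using p12 by (simp_all add: p1_def p2_def)
  have X1: "L2 * r * fst D = - L0 * fst q3 - (L1 + L2) * fst p1"
    "L2 * r * snd D = - L0 * snd q3 - (L1 + L2) * snd p1"
    using W E p by (simp_all add: D_def q3_def prod_eq_iff) algebra+
  have K: "L0 * (L2 * H * fst D + (L1 + L2) * fst q3) = - ((L1 + L2)^2) * fst p1"
    "L0 * (L2 * H * snd D + (L1 + L2) * snd q3) = - ((L1 + L2)^2) * snd p1"
    using X1 E by algebra+
  then have "L0 dvd (L1 + L2)^2 * fst p1" "L0 dvd (L1 + L2)^2 * snd p1"
    by (metis dvd_minus_iff dvd_triv_left mult_minus_left)+
  then have "L0 dvd (L1 + L2)^2" by (rule dvd_if_dvd_primitive_multiple[OF prim])
  then obtain \<kappa> where \<kappa>: "(L1 + L2)^2 = L0 * \<kappa>" by (elim dvdE)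
  have "L0 * (L2 * H * fst D + (L1 + L2) * fst q3) = L0 * (- \<kappa> * fst p1)"
    "L0 * (L2 * H * snd D + (L1 + L2) * snd q3) = L0 * (- \<kappa> * snd p1)"
    using K unfolding \<kappa> by simp_all
  then have "L2 * H * fst D + (L1 + L2) * fst q3 = - \<kappa> * fst p1"
    "L2 * H * snd D + (L1 + L2) * snd q3 = - \<kappa> * snd p1"
    using L0 by (simp_all only: mult_cancel_left, simp_all)
  then have XK: "L2 * H * fst D = - (L1 + L2) * fst q3 - \<kappa> * fst p1"
    "L2 * H * snd D = - (L1 + L2) * snd q3 - \<kappa> * snd p1"
    by (simp_all add: algebra_simps)
  have "gcd L2 (L1 + L2) = gcd L2 L1" by (metis add.commute gcd_add2)
  then have "coprime L2 L0" "coprime L2 (L1 + L2)"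
    using cop by (simp_all add: L0_def L1_def L2_def coprime_commute coprime_iff_gcd_eq_1 gcd.commute)
  then have "sublattice p1 q3 (fst q3 + H * fst D, snd q3 + H * snd D) =
      sublattice q3 p1 (fst p1 + r * fst D, snd p1 + r * snd D)"
    by (rule sublattice_edge_mutation[OF X1 XK E])
  moreover have "(fst q3 + H * fst D, snd q3 + H * snd D) = q4"
    by (simp add: q3_def q4_def D_def algebra_simps)
  moreover have "int_shear w ga v0 = q3" "int_shear w ga v1 = p1"
    "int_shear w ga v2 = (fst p1 + r * fst D, snd p1 + r * snd D)"
    using top bottom p by (simp_all add: int_shear_def q3_def D_def algebra_simps)
  ultimately have "mult p1 q3 q4 = mult (int_shear w ga v0) (int_shear w ga v1) (int_shear w ga v2)"
    using mult_eq_if_sublattice_eq mult_swap(1) by metis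
  also have "\<dots> = mult v0 v1 v2" using mult_int_shear idot_ends by blast
  finally show ?thesis .
qed

lemma mult_mutation:
  assumes Q: "fano_polygon (triangle u0 u1 u2)" and det: "\<bar>a * d - b * c\<bar> = 1"
    and Qe: "triangle u0 u1 u2 = real_lin a b c d ` R"
    and wX: "fwpp_weights v0 v1 v2 l0 l1 l2" and cop: "coprime l0 l2" "coprime l1 l2"
  shows "mult v0 v1 v2 = mult u0 u1 u2"
proof -
  note U = mutation_vertices[OF Q det Qe]
  have "int_lin a b c d p1 \<in> {u0, u1, u2}" using U(2) by simp
  then have "primitive p1"
    using fano_triangle(5-7)[OF Q] primitive_int_lin_imp by blast
  have "mult u0 u1 u2 = mult (int_lin a b c d p1) (int_lin a b c d q3) (int_lin a b c d q4)"
    using U(2) by (rule mult_eq_if_vertices_eq)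
  also have "\<dots> = mult p1 q3 q4" by (rule mult_int_lin[OF det])
  also have "\<dots> = mult v0 v1 v2" by (rule mult_corners[OF wX cop U(1) \<open>primitive p1\<close>])
  finally show ?thesis by simp
qed

end

lemma mult_mutation_edge_bottom:
  assumes P: "fano_polygon (triangle v0 v1 v2)" and Q: "fano_polygon (triangle u0 u1 u2)"
    and fac: "is_factor w (triangle v0 v1 v2) F G" and wu: "idot w u = 1"
    and wX: "fwpp_weights v0 v1 v2 l0 l1 l2" and cop: "coprime l0 l1" "coprime l0 l2" "coprime l1 l2"
    and heights: "idot w v0 > 0" "idot w v1 < 0" "idot w v1 = idot w v2"
    and ends: "lat ga \<in> F" "lat gb \<in> F" "icross u ga < icross u gb"
    and between: "\<And>z. z \<in> F \<Longrightarrow> of_int (icross u ga) \<le> cross u z \<and> cross u z \<le> of_int (icross u gb)"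
    and det: "\<bar>a * d - b * c\<bar> = 1"
    and Qe: "triangle u0 u1 u2 = real_lin a b c d ` mutation w (triangle v0 v1 v2) F G"
  shows "mult v0 v1 v2 = mult u0 u1 u2"
proof -
  have "icross u v1 \<noteq> icross u v2"
  proof
    assume "icross u v1 = icross u v2"
    then have "lat v1 = lat v2"
      by (intro eq_if_pair_cross_eq[OF wu]) (simp_all add: pair_lat cross_lat heights(3))
    then show False using fano_triangle(3)[OF P] by simp
  qed
  then consider "icross u v1 < icross u v2" | "icross u v2 < icross u v1" by linarith
  then show ?thesis
  proof cases
    case 1
    interpret edge_factor v0 v1 v2 w u ga gb "idot w v0" "- idot w v1" F G
      using P fac wu heights 1 ends between by unfold_locales auto
    show ?thesis by (rule mult_mutation[OF Q det Qe wX cop(2,3)])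
  next
    case 2
    interpret edge_factor v0 v2 v1 w u ga gb "idot w v0" "- idot w v1" F G
      using P fac wu heights 2 ends between by unfold_locales (auto simp: triangle_swap)
    have "mult v0 v2 v1 = mult u0 u1 u2"
      by (rule mult_mutation[OF Q det _ fwpp_weights_swap(2)[OF wX] cop(1)])
        (use Qe cop(3) in \<open>simp_all add: triangle_swap coprime_commute\<close>)
    then show ?thesis by (simp add: mult_swap)
  qed
qed

lemma mult_mutation_top_vertex:
  assumes P: "fano_polygon (triangle v0 v1 v2)" and Q: "fano_polygon (triangle u0 u1 u2)"
    and w: "primitive w" and fac: "is_factor w (triangle v0 v1 v2) F G"
    and wX: "fwpp_weights v0 v1 v2 l0 l1 l2" and cop: "coprime l0 l1" "coprime l0 l2" "coprime l1 l2"
    and top: "idot w v1 \<le> idot w v0" "idot w v2 \<le> idot w v0"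
    and det: "\<bar>a * d - b * c\<bar> = 1"
    and Qe: "triangle u0 u1 u2 = real_lin a b c d ` mutation w (triangle v0 v1 v2) F G"
  shows "mult v0 v1 v2 = mult u0 u1 u2"
proof -
  obtain u where wu: "idot w u = 1" using primitive_coordinate[OF w] .
  obtain ga gb where ends: "lat ga \<in> F" "lat gb \<in> F"
    and between: "\<And>z. z \<in> F \<Longrightarrow> of_int (icross u ga) \<le> cross u z \<and> cross u z \<le> of_int (icross u gb)"
    and point: "ga = gb \<Longrightarrow> F = {lat ga}" and segment: "ga \<noteq> gb \<Longrightarrow> icross u ga < icross u gb"
    using factor_endpoints[OF is_factorD(1)[OF fac] _ wu] fac unfolding is_factor_def by metis
  show ?thesis
  proof (cases "ga = gb")
    case True
    then show ?thesis using mult_mutation_point_factor[OF P Q _ det] fac Qe point by simp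
  next
    case False
    have "w \<noteq> (0, 0)" using w by (auto simp: primitive_def)
    note signs = fano_triangle_height_signs[OF P this]
    have "idot w v0 > 0" using signs(1) top by linarith
    moreover note signs(2)
    moreover have V: "lat v1 \<in> vertices (triangle v1 v0 v2)" "lat v2 \<in> vertices (triangle v2 v0 v1)"
      using fano_triangle(4)[OF P] by (auto simp: triangle_def insert_commute)
    ultimately consider "idot w v1 = idot w v2" "idot w v1 < 0"
      | "idot w v1 < idot w v0" "idot w v1 < idot w v2" "idot w v1 < 0"
      | "idot w v2 < idot w v0" "idot w v2 < idot w v1" "idot w v2 < 0" by linarith
    then show ?thesis
    proof cases
      case 1
      then show ?thesis
        using mult_mutation_edge_bottom[OF P Q fac wu wX cop _ _ _ ends(1,2) segment[OF False] between det Qe]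
          \<open>idot w v0 > 0\<close> by simp
    next
      case 2
      have "ga = gb"
        by (rule factor_single_point_if_lowest_vertex_unique[OF _ V(1) 2 ends(1,2)])
          (use fac in \<open>simp add: triangle_def insert_commute\<close>)
      with False show ?thesis by simp
    next
      case 3
      have "ga = gb"
        by (rule factor_single_point_if_lowest_vertex_unique[OF _ V(2) 3 ends(1,2)])
          (use fac in \<open>simp add: triangle_def insert_commute\<close>)
      with False show ?thesis by simp
    qed
  qed
qed

lemma iso_real_lin:
  assumes "iso A B"
  obtains a b c d where "\<bar>a * d - b * c\<bar> = 1" "A = real_lin a b c d ` B"
proof -
  have lin: "(\<lambda>(x, y). (of_int a * x + of_int b * y, of_int c * x + of_int d * y)) = real_lin a b c d"
    for a b c d by (simp add: fun_eq_iff real_lin_def)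
  from assms have "\<exists>a0 b0 c0 d0. \<bar>a0 * d0 - b0 * c0\<bar> = 1 \<and> B = real_lin a0 b0 c0 d0 ` A"
    unfolding iso_def lin .
  then obtain a0 b0 c0 d0 where det0: "\<bar>a0 * d0 - b0 * c0\<bar> = 1" and B: "B = real_lin a0 b0 c0 d0 ` A"
    by blast
  note inv = real_lin_inverse[OF det0]
  show ?thesis using inv(1) by (rule that) (unfold B image_image inv(2), simp)
qed

lemma mult_one_step_mutation:
  assumes P: "fano_polygon (triangle v0 v1 v2)" and Q: "fano_polygon (triangle u0 u1 u2)"
    and mut: "one_step_mutation (triangle v0 v1 v2) (triangle u0 u1 u2)"
    and wX: "fwpp_weights v0 v1 v2 l0 l1 l2" and cop: "coprime l0 l1" "coprime l0 l2" "coprime l1 l2"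
  shows "mult v0 v1 v2 = mult u0 u1 u2"
proof -
  obtain w F G where w: "primitive w" and fac: "is_factor w (triangle v0 v1 v2) F G"
    and iso: "iso (triangle u0 u1 u2) (mutation w (triangle v0 v1 v2) F G)"
    using mut unfolding one_step_mutation_def by blast
  obtain a b c d where det: "\<bar>a * d - b * c\<bar> = 1"
    and Qe: "triangle u0 u1 u2 = real_lin a b c d ` mutation w (triangle v0 v1 v2) F G"
    using iso_real_lin[OF iso] .
  consider "idot w v1 \<le> idot w v0" "idot w v2 \<le> idot w v0"
    | "idot w v0 \<le> idot w v1" "idot w v2 \<le> idot w v1"
    | "idot w v0 \<le> idot w v2" "idot w v1 \<le> idot w v2" by linarith
  then show ?thesis
  proof cases
    case 1
    show ?thesis by (rule mult_mutation_top_vertex[OF P Q w fac wX cop 1 det Qe])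
  next
    case 2
    have "mult v1 v0 v2 = mult u0 u1 u2"
      by (rule mult_mutation_top_vertex[OF _ Q w _ fwpp_weights_swap(1)[OF wX] _ _ _ 2 det])
        (use P fac Qe cop in \<open>simp_all add: triangle_swap coprime_commute\<close>)
    then show ?thesis by (simp add: mult_swap)
  next
    case 3
    have T: "triangle v2 v0 v1 = triangle v0 v1 v2" by (simp add: triangle_def insert_commute)
    have "mult v2 v0 v1 = mult u0 u1 u2"
      by (rule mult_mutation_top_vertex[OF _ Q w _ fwpp_weights_swap(1)[OF fwpp_weights_swap(2)[OF wX]]
            _ _ _ 3 det])
        (use P fac Qe cop in \<open>simp_all add: T coprime_commute\<close>)
    moreover have "mult v2 v0 v1 = mult v0 v1 v2" by (rule mult_eq_if_vertices_eq) auto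
    ultimately show ?thesis by simp
  qed
qed

theorem proposition3p11:
  fixes v0 v1 v2 u0 u1 u2 :: "int \<times> int"
    and l0 l1 l2 l0' a0 a1 a2 a0' c0 c1 c2 c0' :: nat
  assumes P: "fano_polygon (triangle v0 v1 v2)"
    and Q: "fano_polygon (triangle u0 u1 u2)"
    and mut: "one_step_mutation (triangle v0 v1 v2) (triangle u0 u1 u2)"
    and wX: "fwpp_weights v0 v1 v2 l0 l1 l2"
    and wY: "fwpp_weights u0 u1 u2 l0' l1 l2"
    and l0': "l0 * l0' = (l1 + l2)^2"
    and pos: "a0 > 0" "a1 > 0" "a2 > 0" "a0' > 0" "c0 > 0" "c1 > 0" "c2 > 0" "c0' > 0"
    and sf: "squarefree c0" "squarefree c1" "squarefree c2" "squarefree c0'"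
    and dec: "l0 = c0 * a0^2" "l1 = c1 * a1^2" "l2 = c2 * a2^2" "l0' = c0' * a0'^2"
  shows "c0' = c0 \<and>
    deg_ratio l1 l2 l0' = deg_ratio l0 l1 l2 \<and>
    (\<exists>m k r :: nat. m > 0 \<and> k > 0 \<and> r > 0 \<and> squarefree r \<and>
        deg_ratio l0 l1 l2 = of_nat (m^2) / of_nat (r * k^2)) \<and>
    (\<forall>m k r :: nat. m > 0 \<and> k > 0 \<and> r > 0 \<and> squarefree r \<and>
        deg_ratio l0 l1 l2 = of_nat (m^2) / of_nat (r * k^2) \<longrightarrow>
        m * a0 * a1 * a2 = k * (c0 * a0^2 + c1 * a1^2 + c2 * a2^2) \<and>
        m * a0' * a1 * a2 = k * (c0 * a0'^2 + c1 * a1^2 + c2 * a2^2)) \<and>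
    mult v0 v1 v2 = mult u0 u1 u2"
proof -
  note cop = fano_weights_pairwise_coprime[OF P wX]
  have c0': "c0' = c0"
    using squarefree_part_mutation[OF _ sf(1,4) pos(1,4)] l0' dec(1,4) by simp
  have DR: "deg_ratio l1 l2 l0' = deg_ratio l0 l1 l2"
    using deg_ratio_mutation l0' pos dec by simp
  have C: "squarefree (c0 * c1 * c2)"
    by (rule squarefree_product_of_coprime_parts[of c0 c1 c2 a0 a1 a2, OF sf(1-3)])
      (use cop in \<open>simp_all only: dec\<close>)
  note X = deg_ratio_squarefree_presentation[of a0 a1 a2 c0 c1 c2, OF pos(1-3,5-7)]
  note Y = deg_ratio_squarefree_presentation[of a0' a1 a2 c0 c1 c2, OF pos(4,2,3,5-7)]
  have Y_ratio: "deg_ratio (c0 * a0'^2) (c1 * a1^2) (c2 * a2^2) = deg_ratio l0 l1 l2"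
    using DR deg_ratio_rotate[of l1 l2 l0'] dec(2-4) c0' by simp
  show ?thesis
  proof (intro conjI allI impI)
    show "c0' = c0" "deg_ratio l1 l2 l0' = deg_ratio l0 l1 l2" by (fact c0' DR)+
    show "mult v0 v1 v2 = mult u0 u1 u2" by (rule mult_one_step_mutation[OF P Q mut wX cop])
    show "\<exists>m k r :: nat. m > 0 \<and> k > 0 \<and> r > 0 \<and> squarefree r \<and>
        deg_ratio l0 l1 l2 = of_nat (m^2) / of_nat (r * k^2)"
      using X(1) C pos unfolding dec(1-3)
      by (intro exI[of _ "c0 * a0^2 + c1 * a1^2 + c2 * a2^2"] exI[of _ "a0 * a1 * a2"]
          exI[of _ "c0 * c1 * c2"]) simp
  next
    fix m k r :: nat
    assume "m > 0 \<and> k > 0 \<and> r > 0 \<and> squarefree r \<and> deg_ratio l0 l1 l2 = of_nat (m^2) / of_nat (r * k^2)"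
    then have "m * (a0 * a1 * a2) = k * (c0 * a0^2 + c1 * a1^2 + c2 * a2^2)"
      "m * (a0' * a1 * a2) = k * (c0 * a0'^2 + c1 * a1^2 + c2 * a2^2)"
      using X(2)[OF C] Y(2)[OF C] Y_ratio unfolding dec(1-3) by auto
    then show "m * a0 * a1 * a2 = k * (c0 * a0^2 + c1 * a1^2 + c2 * a2^2)"
      "m * a0' * a1 * a2 = k * (c0 * a0'^2 + c1 * a1^2 + c2 * a2^2)" by (simp_all add: mult.assoc)
  qed
qed

end
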